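(* Let $n\geq 1$ be an integer. There exists a constant $C=C_n>0$, which only depends on $n$, such that the following hold. (i) If $s>\frac{n-2}{2}$, then $$\Vert\partial_tS(t)g\Vert_{L^\infty(\mathbb{R}^n)}\leq C\,t^{-\frac n2}\Vert g\Vert_{L^1(\mathbb{R}^n)}+C\,e^{-\frac t4}\Vert g\Vert_{H^{s+1}(\mathbb{R}^n)},$$ $$\Vert S(t)\Delta g\Vert_{L^\infty(\mathbb{R}^n)}\leq C\,t^{-\frac n2}\Vert g\Vert_{L^1(\mathbb{R}^n)}+C\,e^{-\frac t4}\Vert g\Vert_{H^{s+2}(\mathbb{R}^n)},$$ for all $g\in\mathscr{S}(\mathbb{R}^n)$ and $t>0$. (ii) If $s\in\mathbb{R}$ and $k=0,1$, then $$\Vert\partial_t^{k+1}S(t)g\Vert_{H^{s-k}(\mathbb{R}^n)}\leq C\Vert g\Vert_{H^s(\mathbb{R}^n)},$$ $$\Vert\partial_t^kS(t)\Delta g\Vert_{H^{s-k}(\mathbb{R}^n)}\leq C\Vert g\Vert_{H^{s+1}(\mathbb{R}^n)},$$ for all $g\in\mathscr{S}(\mathbb{R}^n)$ and $t>0$.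
   Context: For $t\geq 0$, $S(t)$ is the Fourier multiplier operator on $\mathbb{R}^n$ with symbol $$m(\xi,t)=e^{-\frac{|\xi|^2t}{2(1+|\xi|^2)}}\,\frac{2(1+|\xi|^2)}{|\xi|^2\sqrt{3+4|\xi|^2}}\,\sin\left(\frac{|\xi|^2\sqrt{3+4|\xi|^2}\,t}{2(1+|\xi|^2)}\right)$$ (equal to $t$ at $\xi=0$), and $\partial_t^kS(t)$ is the Fourier multiplier operator with symbol $\partial_t^km(\xi,t)$. $\mathscr{S}(\mathbb{R}^n)$ is the Schwartz space and $H^s(\mathbb{R}^n)$ the $L^2$-based Sobolev space.
   Formalization: In (i) the constant in front of the Sobolev-norm terms may depend on s as well as n, since a constant depending only on n fails as s decreases to (n-2)/2; the constant on the L^1 terms and in (ii) depends only on n. *)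

theory Defs
  imports "HOL-Analysis.Analysis" "HOL-Probability.Essential_Supremum"
begin

definition partial_deriv :: "'n::finite \<Rightarrow> (real^'n \<Rightarrow> complex) \<Rightarrow> real^'n \<Rightarrow> complex" where
  "partial_deriv i f x = frechet_derivative f (at x) (axis i 1)"

text \<open>
  A list of indices plays the role of a multi-index. Differentiability of all iterated partial
  derivatives amounts to smoothness, and it makes every \<^const>\<open>frechet_derivative\<close> involved
  a genuine derivative.
\<close>

definition schwartz :: "(real^'n::finite \<Rightarrow> complex) set" where
  "schwartz = {f. \<forall>is :: 'n list.
     (\<forall>x. foldr partial_deriv is f differentiable at x) \<and>
     (\<forall>N :: nat. bounded (range (\<lambda>x. norm x ^ N *\<^sub>R foldr partial_deriv is f x)))}"

definition laplacian :: "(real^'n::finite \<Rightarrow> complex) \<Rightarrow> real^'n \<Rightarrow> complex" where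
  "laplacian f x = (\<Sum>i\<in>UNIV. partial_deriv i (partial_deriv i f) x)"

text \<open>
  Unitary normalisation with angular frequency, so that the Laplacian has symbol
  \<open>- |\<xi>|\<^sup>2\<close> and the Sobolev norm of order \<open>0\<close> is the \<open>L\<^sup>2\<close> norm.
\<close>

definition fourier :: "(real^'n::finite \<Rightarrow> complex) \<Rightarrow> real^'n \<Rightarrow> complex" where
  "fourier f \<xi> = (2 * pi) powr (- real CARD('n) / 2) *\<^sub>R
     (LINT x|lborel. cis (- (x \<bullet> \<xi>)) * f x)"

definition inverse_fourier :: "(real^'n::finite \<Rightarrow> complex) \<Rightarrow> real^'n \<Rightarrow> complex" where
  "inverse_fourier F x = (2 * pi) powr (- real CARD('n) / 2) *\<^sub>R
     (LINT \<xi>|lborel. cis (x \<bullet> \<xi>) * F \<xi>)"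

definition fourier_multiplier ::
    "(real^'n::finite \<Rightarrow> real) \<Rightarrow> (real^'n \<Rightarrow> complex) \<Rightarrow> real^'n \<Rightarrow> complex" where
  "fourier_multiplier p g = inverse_fourier (\<lambda>\<xi>. of_real (p \<xi>) * fourier g \<xi>)"

definition symb :: "real^'n::finite \<Rightarrow> real \<Rightarrow> real" where
  "symb \<xi> t = (if \<xi> = 0 then t else
     exp (- (norm \<xi> ^ 2 * t / (2 * (1 + norm \<xi> ^ 2))))
     * (2 * (1 + norm \<xi> ^ 2) / (norm \<xi> ^ 2 * sqrt (3 + 4 * norm \<xi> ^ 2)))
     * sin (norm \<xi> ^ 2 * sqrt (3 + 4 * norm \<xi> ^ 2) * t / (2 * (1 + norm \<xi> ^ 2))))"

text \<open>\<open>dS k t\<close> is the operator \<open>\<partial>\<^sub>t\<^sup>k S(t)\<close>; in particular \<open>dS 0 t\<close> is \<open>S(t)\<close>.\<close>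

definition dS ::
    "nat \<Rightarrow> real \<Rightarrow> (real^'n::finite \<Rightarrow> complex) \<Rightarrow> real^'n \<Rightarrow> complex" where
  "dS k t = fourier_multiplier (\<lambda>\<xi>. (deriv ^^ k) (symb \<xi>) t)"

text \<open>
  The norms take values in the extended nonnegative reals, so that an infinite norm is not
  mistaken for \<open>0\<close>.
\<close>

definition L1_norm :: "(real^'n::finite \<Rightarrow> complex) \<Rightarrow> ennreal" where
  "L1_norm f = (\<integral>\<^sup>+ x. ennreal (norm (f x)) \<partial>lborel)"

definition Linf_norm :: "(real^'n::finite \<Rightarrow> complex) \<Rightarrow> ennreal" where
  "Linf_norm f = esssup lborel (\<lambda>x. ennreal (norm (f x)))"

definition L2_norm :: "(real^'n::finite \<Rightarrow> complex) \<Rightarrow> ennreal" where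
  "L2_norm f = (let I = \<integral>\<^sup>+ x. ennreal (norm (f x) ^ 2) \<partial>lborel
     in if I = \<infinity> then \<infinity> else ennreal (sqrt (enn2real I)))"

text \<open>
  The \<open>H\<^sup>s\<close> norm of an integrable function, whose Fourier transform is given by the integral;
  it is only applied to Schwartz functions and to their images under \<open>dS\<close>, which are again
  Schwartz because the symbols are smooth in \<open>\<xi>\<close> with polynomially bounded derivatives.
  The embedding of \<open>H\<^sup>s\<close> into \<open>L\<^sup>\<infinity>\<close> has a constant that blows up as \<open>s\<close> decreases to
  \<open>n/2\<close>, so in an \<open>L\<^sup>\<infinity>\<close> bound the factor of a Sobolev norm has to depend on \<open>s\<close>.
\<close>

definition sobolev_norm :: "real \<Rightarrow> (real^'n::finite \<Rightarrow> complex) \<Rightarrow> ennreal" where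
  "sobolev_norm s f = L2_norm (\<lambda>\<xi>. (1 + norm \<xi> ^ 2) powr (s / 2) *\<^sub>R fourier f \<xi>)"

end

theory Submission
  imports Defs "HOL-Probability.Characteristic_Functions"
begin

text \<open>
  Write \<open>r = |\<xi>|\<^sup>2\<close>, \<open>a = r / (2 (1 + r))\<close> and \<open>b = r \<surd>(3 + 4 r) / (2 (1 + r))\<close>, so that the symbol is
  \<open>m = exp (- a t) sin (b t) / b\<close> and \<open>a / b = 1 / \<surd>(3 + 4 r)\<close>. Hence \<open>\<partial>\<^sub>t m\<close> is bounded by
  \<open>2 exp (- a t)\<close>, and both \<open>r m\<close> and \<open>\<partial>\<^sub>t\<^sup>2 m\<close> are at most of order \<open>\<surd>(1 + r)\<close>.

  For the \<open>L\<^sup>\<infinity>\<close> bounds no oscillation is needed. Where \<open>|\<xi>| \<le> 1\<close>, \<open>a \<ge> r / 4\<close>; bounding the Fourier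
  transform of \<open>g\<close> by the \<open>L\<^sup>1\<close> norm leaves a Gaussian integral of size \<open>t\<^bsup>-n/2\<^esup>\<close>. Where
  \<open>|\<xi>| > 1\<close>, \<open>a \<ge> 1 / 4\<close>, and Cauchy-Schwarz against \<open>(1 + r)\<^bsup>-(s+1)\<^esup>\<close>, integrable as
  \<open>s + 1 > n / 2\<close>, gives the Sobolev term.

  The Sobolev bounds are pointwise bounds on the symbols once Fourier inversion is available for
  bounded, continuous, integrable functions; this is obtained by Gaussian regularisation.
\<close>

section \<open>Weights and Gaussians\<close>

text \<open>A dyadic decomposition: the weight on the shell between radii 2^(k-1) and 2^k is at most
  q^(k-1) with q = 2^(-2 \<sigma>), while the ball of radius 2^k has volume of order 2^(n k). The
  resulting geometric series has ratio q * 2^n, which is below 1 exactly when \<sigma> > n /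
  2.\<close>

lemma nn_integral_bessel_weight_finite:
  assumes \<sigma>: "\<sigma> > real DIM('a::euclidean_space) / 2"
  shows "(\<integral>\<^sup>+ x. ennreal ((1 + norm (x::'a) ^ 2) powr (- \<sigma>)) \<partial>lborel) < \<infinity>"
proof -
  define q where "q = 2 powr (-2 * \<sigma>)"
  define n where "n = DIM('a)"
  have q0: "q > 0" by (simp add: q_def)
  have \<sigma>0: "\<sigma> > 0" using \<sigma> le_less_trans[of 0 "real DIM('a) / 2" \<sigma>] by simp
  have dyadic: "ennreal ((1 + norm x ^ 2) powr (- \<sigma>))
      \<le> (\<Sum>k. ennreal (inverse q * q ^ k) * indicator (ball 0 (2 ^ k)) x)" for x :: 'a
  proof -
    \<comment> \<open>The index of the smallest dyadic ball containing \<open>x\<close>; its single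
      term of the series already dominates the weight.\<close>
    define k where "k = (LEAST k. norm x < 2 ^ k)"
    have "\<exists>k. norm x < 2 ^ k" by (rule real_arch_pow) simp
    then have k: "norm x < 2 ^ k" unfolding k_def by (rule LeastI_ex)
    have "(1 + norm x ^ 2) powr (- \<sigma>) \<le> inverse q * q ^ k"
    proof (cases k)
      \<comment> \<open>There is no inner ball here, so the weight is only bounded by 1; the
        prefactor \<open>inverse q\<close> is at least 1 and covers this.\<close>
      case 0
      have "(1 + norm x ^ 2) powr (- \<sigma>) \<le> 1 powr (- \<sigma>)"
        by (rule powr_mono2') (use \<sigma>0 in auto)
      also have "\<dots> \<le> inverse q"
        using q0 \<sigma>0 by (simp add: q_def powr_minus[symmetric] ge_one_powr_ge_zero)
      finally show ?thesis using 0 by simp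
    next
      case (Suc j)
      have "\<not> norm x < 2 ^ j" using not_less_Least[of j "\<lambda>k. norm x < 2 ^ k"] Suc
        by (simp add: k_def)
      then have "(2 ^ j) ^ 2 \<le> norm x ^ 2" by (intro power_mono) auto
      then have "(2 ^ j) ^ 2 \<le> 1 + norm x ^ 2" by linarith
      then have "(1 + norm x ^ 2) powr (- \<sigma>) \<le> ((2 ^ j) ^ 2) powr (- \<sigma>)"
        by (intro powr_mono2') (use \<sigma>0 in auto)
      also have "((2::real) ^ j) ^ 2 = 2 powr (2 * j)"
        by (simp add: powr_realpow power_mult[symmetric] mult.commute flip: of_nat_mult)
      also have "\<dots> powr (- \<sigma>) = q ^ j"
        by (simp add: q_def powr_powr powr_realpow[symmetric] mult_ac)
      also have "\<dots> = inverse q * q ^ k" using Suc q0 by simp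
      finally show ?thesis .
    qed
    then have "ennreal ((1 + norm x ^ 2) powr (- \<sigma>))
        \<le> (\<Sum>i\<in>{k}. ennreal (inverse q * q ^ i) * indicator (ball 0 (2 ^ i)) x)"
      using k by (simp add: ennreal_leI)
    also have "\<dots> \<le> (\<Sum>k. ennreal (inverse q * q ^ k) * indicator (ball 0 (2 ^ k)) x)"
      by (rule sum_le_suminf) auto
    finally show ?thesis .
  qed
  have "(\<integral>\<^sup>+ x. ennreal ((1 + norm (x::'a) ^ 2) powr (- \<sigma>)) \<partial>lborel)
      \<le> (\<integral>\<^sup>+ x. (\<Sum>k. ennreal (inverse q * q ^ k) * indicator (ball 0 (2 ^ k)) (x::'a)) \<partial>lborel)"
    by (intro nn_integral_mono dyadic)
  also have "\<dots> = (\<Sum>k. ennreal (inverse q * q ^ k) * emeasure lborel (ball (0::'a) (2 ^ k)))"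
    by (subst nn_integral_suminf)
      (auto simp: nn_integral_cmult_indicator intro!: borel_measurable_times_ennreal borel_measurable_indicator)
  also have "\<dots> = (\<Sum>k. ennreal (inverse q * unit_ball_vol n * (q * 2 ^ n) ^ k))"
    using q0 by (intro suminf_cong)
      (simp add: emeasure_ball ennreal_mult[symmetric] n_def power_mult_distrib power_mult[symmetric] mult_ac)
  also have "\<dots> < \<infinity>"
  proof -
    have "q * 2 ^ n = 2 powr (real n - 2 * \<sigma>)"
      by (simp add: q_def powr_realpow[symmetric] powr_add[symmetric])
    also have "\<dots> < 1" using powr_less_mono[of "real n - 2 * \<sigma>" 0 2] \<sigma> by (simp add: n_def)
    finally have "summable (\<lambda>k. inverse q * unit_ball_vol n * (q * 2 ^ n) ^ k)"
      using q0 by (intro summable_mult summable_geometric) simp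
    then have "(\<Sum>k. ennreal (inverse q * unit_ball_vol n * (q * 2 ^ n) ^ k)) \<noteq> \<infinity>"
      unfolding infinity_ennreal_def by (intro ennreal_suminf_neq_top) (use q0 in auto)
    then show ?thesis by (simp add: top.not_eq_extremum)
  qed
  finally show ?thesis .
qed

lemma integrable_bessel_weight:
  assumes "\<sigma> > real DIM('a::euclidean_space) / 2"
  shows "integrable lborel (\<lambda>x::'a. (1 + norm x ^ 2) powr (- \<sigma>))"
  using nn_integral_bessel_weight_finite[OF assms] by (intro integrableI_bounded) auto

text \<open>\<open>lborel\<close> is by definition the image of the product of the one-dimensional
  measures under the map from coordinates to vectors, so the claim reduces to Fubini for finite
  products.\<close>

lemma lborel_prod_coordinates:
  fixes h :: "'a::euclidean_space \<Rightarrow> real \<Rightarrow> 'b::{real_normed_field,banach,second_countable_topology}"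
  assumes h: "\<And>b. b \<in> Basis \<Longrightarrow> integrable lborel (h b)"
  shows "integrable lborel (\<lambda>x. \<Prod>b\<in>Basis. h b (x \<bullet> b))" (is ?A)
    and "(LINT x|lborel. (\<Prod>b\<in>Basis. h b (x \<bullet> b))) = (\<Prod>b\<in>Basis. LINT u|lborel. h b u)" (is ?B)
proof -
  interpret product_sigma_finite "\<lambda>_::'a. lborel :: real measure" ..
  have m[measurable]: "h b \<in> borel_measurable borel" if "b \<in> Basis" for b
    using borel_measurable_integrable[OF h[OF that]] by simp
  have eq: "(\<Prod>b\<in>Basis. h b ((\<Sum>c\<in>Basis. f c *\<^sub>R c) \<bullet> b)) = (\<Prod>b\<in>Basis. h b (f b))" for f :: "'a \<Rightarrow> real"
    by (intro prod.cong refl) simp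
  have prod: "integrable (Pi\<^sub>M Basis (\<lambda>_::'a. lborel)) (\<lambda>f. \<Prod>b\<in>Basis. h b (f b))"
    by (rule product_integrable_prod) (auto intro: h)
  show ?A
    unfolding lborel_def[where 'a='a] by (subst integrable_distr_eq) (auto simp: eq prod[unfolded lborel_eq_real])
  have "(LINT x|lborel. (\<Prod>b\<in>Basis. h b (x \<bullet> b)))
      = (LINT f|Pi\<^sub>M Basis (\<lambda>_::'a. lborel). (\<Prod>b\<in>Basis. h b (f b)))"
    unfolding lborel_def[where 'a='a] by (subst integral_distr) (auto simp: eq lborel_eq_real)
  also have "\<dots> = (\<Prod>b\<in>Basis. LINT u|lborel. h b u)"
    by (rule product_integral_prod) (auto intro: h)
  finally show ?B .
qed

text \<open>One change of variables for two purposes: a dilation rescales Gaussians, and a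
  translation (\<open>c = 1\<close>) turns a shift of the function into a phase of its Fourier
  transform.\<close>

lemma lborel_integral_affine:
  fixes f :: "'a::euclidean_space \<Rightarrow> 'b::{banach,second_countable_topology}"
  assumes f[measurable]: "f \<in> borel_measurable borel" and c: "c \<noteq> 0"
  shows "(LINT x|lborel. f x) = \<bar>c\<bar> ^ DIM('a) *\<^sub>R (LINT x|lborel. f (a + c *\<^sub>R x))"
  by (subst lborel_affine[OF c, of a]) (simp add: integral_density integral_distr)

lemma lborel_integrable_affine:
  fixes f :: "'a::euclidean_space \<Rightarrow> 'b::{banach,second_countable_topology}"
  assumes f: "integrable lborel f" and c: "c \<noteq> 0"
  shows "integrable lborel (\<lambda>x. f (a + c *\<^sub>R x))"
proof -
  have [measurable]: "f \<in> borel_measurable borel" using borel_measurable_integrable[OF f] by simp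
  have "integrable lborel (\<lambda>x. \<bar>c\<bar> ^ DIM('a) *\<^sub>R f (a + c *\<^sub>R x))"
    using f by (subst (asm) lborel_affine[OF c, of a]) (simp add: integrable_density integrable_distr_eq)
  from integrable_scaleR_right[OF this, of "inverse (\<bar>c\<bar> ^ DIM('a))"] show ?thesis
    using c by simp
qed

section \<open>The Fourier transform of the Gaussian\<close>

lemma cis_measurable [measurable]: "cis \<in> borel_measurable borel"
  by (intro borel_measurable_continuous_onI continuous_intros)

text \<open>Up to the factor sqrt(2 pi) this is the standard normal density, whose characteristic
  function is known.\<close>

lemma one_dim_gaussian:
  shows "integrable lborel (\<lambda>u::real. exp (- u\<^sup>2 / 2))"
    and "(LINT u|lborel. of_real (exp (- u\<^sup>2 / 2)) * cis (u * s))
      = complex_of_real (sqrt (2 * pi) * exp (- s\<^sup>2 / 2))"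
proof -
  have eq: "exp (- u\<^sup>2 / 2) = sqrt (2 * pi) * std_normal_density u" for u :: real
    by (simp add: std_normal_density_def)
  show "integrable lborel (\<lambda>u::real. exp (- u\<^sup>2 / 2))"
    unfolding eq by (intro integrable_mult_right integrable_normal_density) simp
  have "(LINT u|lborel. std_normal_density u *\<^sub>R cis (u * s)) = char std_normal_distribution s"
    unfolding char_def
    by (subst integral_density) (auto simp: cis_conv_exp mult_ac normal_density_nonneg)
  also have "\<dots> = of_real (exp (- s\<^sup>2 / 2))" by (simp add: char_std_normal_distribution)
  finally have "(LINT u|lborel. std_normal_density u *\<^sub>R cis (u * s)) = of_real (exp (- s\<^sup>2 / 2))" .
  moreover have "(\<lambda>u. of_real (exp (- u\<^sup>2 / 2)) * cis (u * s))
      = (\<lambda>u. sqrt (2 * pi) *\<^sub>R (std_normal_density u *\<^sub>R cis (u * s)))"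
    unfolding eq by (simp add: scaleR_conv_of_real mult.assoc)
  ultimately show "(LINT u|lborel. of_real (exp (- u\<^sup>2 / 2)) * cis (u * s))
      = complex_of_real (sqrt (2 * pi) * exp (- s\<^sup>2 / 2))"
    by (simp add: scaleR_conv_of_real del: std_normal_density_def)
qed

text \<open>The variance is chosen so that the function is its own Fourier transform in the unitary
  normalisation.\<close>

definition gauss :: "'a::euclidean_space \<Rightarrow> real" where
  "gauss x = exp (- (norm x)\<^sup>2 / 2)"

lemma gauss_eq_prod: "gauss x = (\<Prod>b\<in>Basis. exp (- (x \<bullet> b)\<^sup>2 / 2))"
proof -
  have "(norm x)\<^sup>2 = (\<Sum>b\<in>Basis. (x \<bullet> b)\<^sup>2)"
    unfolding power2_norm_eq_inner euclidean_inner[of x x] by (simp add: power2_eq_square)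
  then show ?thesis
    by (simp add: gauss_def exp_sum[symmetric] sum_negf sum_divide_distrib)
qed

lemma gauss_measurable [measurable]: "gauss \<in> borel_measurable borel"
  unfolding gauss_def by measurable

lemma gauss_pos: "gauss x > 0" and gauss_le_1: "gauss x \<le> 1"
  by (auto simp: gauss_def)

lemma integrable_gauss: "integrable lborel (gauss :: 'a::euclidean_space \<Rightarrow> real)"
  unfolding gauss_eq_prod by (rule lborel_prod_coordinates(1)) (rule one_dim_gaussian(1))

text \<open>Both the Gaussian and the phase split into one factor per coordinate, which leaves a
  product of one-dimensional transforms.\<close>

lemma fourier_gauss:
  fixes y :: "'a::euclidean_space"
  shows "(LINT x|lborel. of_real (gauss x) * cis (x \<bullet> y))
    = complex_of_real ((2 * pi) powr (real DIM('a) / 2) * gauss y)"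
proof -
  have cis_sum: "cis (sum f A) = (\<Prod>b\<in>A. cis (f b))" for f :: "'a \<Rightarrow> real" and A
    by (induction A rule: infinite_finite_induct) (auto simp: cis_mult[symmetric])
  define h where "h = (\<lambda>b::'a. \<lambda>u. complex_of_real (exp (- u\<^sup>2 / 2)) * cis (u * (y \<bullet> b)))"
  have eq: "of_real (gauss x) * cis (x \<bullet> y) = (\<Prod>b\<in>Basis. h b (x \<bullet> b))" for x
    unfolding h_def prod.distrib gauss_eq_prod euclidean_inner[of x y] cis_sum by simp
  have int: "integrable lborel (h b)" for b
    unfolding h_def by (rule Bochner_Integration.integrable_bound[OF one_dim_gaussian(1)])
      (auto simp: norm_mult, measurable)
  have "(LINT x|lborel. of_real (gauss x) * cis (x \<bullet> y)) = (\<Prod>b\<in>Basis. LINT u|lborel. h b u)"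
    unfolding eq by (rule lborel_prod_coordinates(2)) (rule int)
  also have "\<dots> = (\<Prod>b\<in>Basis. of_real (sqrt (2 * pi) * exp (- (y \<bullet> b)\<^sup>2 / 2)))"
    unfolding h_def one_dim_gaussian ..
  also have "\<dots> = complex_of_real (sqrt (2 * pi) ^ DIM('a) * gauss y)"
    by (simp add: prod.distrib gauss_eq_prod)
  also have "sqrt (2 * pi) ^ DIM('a) = (2 * pi) powr (real DIM('a) / 2)"
    by (simp add: powr_half_sqrt[symmetric] powr_realpow[symmetric] powr_powr)
  finally show ?thesis .
qed

lemma integral_gauss: "(LINT x|lborel. gauss (x::'a::euclidean_space)) = (2 * pi) powr (real DIM('a) / 2)"
proof -
  have "complex_of_real (LINT x|lborel. gauss (x::'a)) = of_real ((2 * pi) powr (real DIM('a) / 2))"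
    using fourier_gauss[of "0::'a"] by (simp add: gauss_def)
  then show ?thesis by (simp only: of_real_eq_iff)
qed

section \<open>Fourier inversion\<close>

text \<open>Fubini: the phase has modulus 1, so the double integrand is dominated by |G(x)|
  |F(\<xi>)|, which is integrable on the product.\<close>

lemma fourier_multiplication_formula:
  fixes F G :: "'a::euclidean_space \<Rightarrow> complex"
  assumes F: "integrable lborel F" and G: "integrable lborel G"
  shows "(LINT x|lborel. G x * (LINT \<xi>|lborel. cis (x \<bullet> \<xi>) * F \<xi>))
    = (LINT \<xi>|lborel. F \<xi> * (LINT x|lborel. cis (x \<bullet> \<xi>) * G x))"
proof -
  have [measurable]: "F \<in> borel_measurable borel" "G \<in> borel_measurable borel"
    using borel_measurable_integrable[OF F] borel_measurable_integrable[OF G] by auto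
  let ?H = "\<lambda>x \<xi>. G x * (cis (x \<bullet> \<xi>) * F \<xi>)"
  have "integrable (lborel \<Otimes>\<^sub>M lborel) (case_prod ?H)"
  proof (rule lborel_pair.Fubini_integrable)
    show "integrable lborel (\<lambda>x. LINT y|lborel. norm (case (x, y) of (x, \<xi>) \<Rightarrow> ?H x \<xi>))"
      using G by (simp add: norm_mult)
    have "integrable lborel (?H x)" for x
      by (rule Bochner_Integration.integrable_bound[OF integrable_mult_right[OF F, of "norm (G x)"]])
        (auto simp: norm_mult)
    then show "AE x in lborel. integrable lborel (\<lambda>y. case (x, y) of (x, \<xi>) \<Rightarrow> ?H x \<xi>)"
      by simp
  qed measurable
  from lborel_pair.Fubini_integral[OF this]
  have "(LINT x|lborel. LINT \<xi>|lborel. ?H x \<xi>) = (LINT \<xi>|lborel. LINT x|lborel. ?H x \<xi>)" ..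
  also have "\<dots> = (LINT \<xi>|lborel. LINT x|lborel. F \<xi> * (cis (x \<bullet> \<xi>) * G x))"
    by (simp add: mult_ac)
  finally show ?thesis by simp
qed

text \<open>The outer integral is damped by the factor gauss(\<epsilon> x). The multiplication
  formula turns the damped integral into an average of \<open>F\<close> against a Gaussian of width
  \<epsilon> around the given frequency. As \<epsilon> tends to 0, one side converges by
  integrability of \<open>f\<close>, the other by boundedness of \<open>F\<close> and its continuity
  at that point.\<close>

lemma fourier_inversion_unnormalised:
  fixes F :: "'a::euclidean_space \<Rightarrow> complex"
  assumes F: "integrable lborel F" and bd: "\<And>\<xi>. norm (F \<xi>) \<le> B" and cont: "isCont F \<xi>\<^sub>0"
    and f_def: "f = (\<lambda>x. LINT \<xi>|lborel. cis (x \<bullet> \<xi>) * F \<xi>)" and f: "integrable lborel f"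
  shows "(LINT x|lborel. cis (- (x \<bullet> \<xi>\<^sub>0)) * f x) = of_real ((2 * pi) ^ DIM('a)) * F \<xi>\<^sub>0"
proof -
  have [measurable]: "F \<in> borel_measurable borel" "f \<in> borel_measurable borel"
    using borel_measurable_integrable[OF F] borel_measurable_integrable[OF f] by auto
  define c where "c = (2 * pi) powr (real DIM('a) / 2)"
  define \<epsilon> where "\<epsilon> k = inverse (real (Suc k))" for k
  have \<epsilon>0: "\<epsilon> k > 0" for k by (simp add: \<epsilon>_def)
  have \<epsilon>lim: "\<epsilon> \<longlonglongrightarrow> 0" unfolding \<epsilon>_def by (rule LIMSEQ_inverse_real_of_nat)
  define L where "L k = (LINT x|lborel. (of_real (gauss (\<epsilon> k *\<^sub>R x)) * cis (- (x \<bullet> \<xi>\<^sub>0))) * f x)" for k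
  have lim: "L \<longlonglongrightarrow> (LINT x|lborel. cis (- (x \<bullet> \<xi>\<^sub>0)) * f x)"
    unfolding L_def
  proof (rule integral_dominated_convergence[where w="\<lambda>x. norm (f x)"])
    show "AE x in lborel. (\<lambda>k. of_real (gauss (\<epsilon> k *\<^sub>R x)) * cis (- (x \<bullet> \<xi>\<^sub>0)) * f x)
        \<longlonglongrightarrow> cis (- (x \<bullet> \<xi>\<^sub>0)) * f x"
    proof (intro AE_I2)
      fix x :: 'a
      have "(\<lambda>k. gauss (\<epsilon> k *\<^sub>R x)) \<longlonglongrightarrow> gauss (0 *\<^sub>R x)"
        unfolding gauss_def by (intro tendsto_intros \<epsilon>lim) simp
      then have "(\<lambda>k. complex_of_real (gauss (\<epsilon> k *\<^sub>R x)) * cis (- (x \<bullet> \<xi>\<^sub>0)) * f x)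
          \<longlonglongrightarrow> of_real (gauss (0 *\<^sub>R x)) * cis (- (x \<bullet> \<xi>\<^sub>0)) * f x"
        by (intro tendsto_intros)
      then show "(\<lambda>k. of_real (gauss (\<epsilon> k *\<^sub>R x)) * cis (- (x \<bullet> \<xi>\<^sub>0)) * f x)
        \<longlonglongrightarrow> cis (- (x \<bullet> \<xi>\<^sub>0)) * f x"
        by (simp add: gauss_def)
    qed
    show "AE x in lborel. norm (of_real (gauss (\<epsilon> k *\<^sub>R x)) * cis (- (x \<bullet> \<xi>\<^sub>0)) * f x) \<le> norm (f x)" for k
      by (intro AE_I2) (simp add: norm_mult gauss_pos less_imp_le gauss_le_1 mult_left_le_one_le)
  qed (use f in auto)
  have L_eq: "L k = (LINT \<eta>|lborel. of_real (c * gauss \<eta>) * F (\<xi>\<^sub>0 + \<epsilon> k *\<^sub>R \<eta>))" for k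
  proof -
    define G where "G x = complex_of_real (gauss (\<epsilon> k *\<^sub>R x)) * cis (- (x \<bullet> \<xi>\<^sub>0))" for x :: 'a
    have "integrable lborel (\<lambda>x. gauss (0 + \<epsilon> k *\<^sub>R x :: 'a))"
      using \<epsilon>0[of k] by (intro lborel_integrable_affine integrable_gauss) simp
    then have "integrable lborel G"
      unfolding G_def by (rule Bochner_Integration.integrable_bound) (auto simp: norm_mult)
    then have L: "L k = (LINT \<xi>|lborel. F \<xi> * (LINT x|lborel. cis (x \<bullet> \<xi>) * G x))"
      using fourier_multiplication_formula[OF F, of G] unfolding L_def f_def G_def by simp
    \<comment> \<open>The transform of the dilated, modulated Gaussian is again a Gaussian, now
      concentrated at the given frequency with height of order \<epsilon>^(-n).\<close>
    have inner: "(LINT x|lborel. cis (x \<bullet> \<xi>) * G x)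
        = inverse (\<epsilon> k ^ DIM('a)) *\<^sub>R of_real (c * gauss ((\<xi> - \<xi>\<^sub>0) /\<^sub>R \<epsilon> k))" for \<xi>
    proof -
      let ?y = "(\<xi> - \<xi>\<^sub>0) /\<^sub>R \<epsilon> k"
      have "cis (x \<bullet> \<xi>) * G x = of_real (gauss (0 + \<epsilon> k *\<^sub>R x)) * cis ((0 + \<epsilon> k *\<^sub>R x) \<bullet> ?y)" for x
        using \<epsilon>0[of k] by (simp add: G_def cis_mult inner_diff_right field_simps)
      moreover have "complex_of_real (c * gauss ?y)
          = \<bar>\<epsilon> k\<bar> ^ DIM('a) *\<^sub>R (LINT x|lborel. of_real (gauss (0 + \<epsilon> k *\<^sub>R x)) * cis ((0 + \<epsilon> k *\<^sub>R x) \<bullet> ?y))"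
        using \<epsilon>0[of k] unfolding c_def fourier_gauss[symmetric]
        by (intro lborel_integral_affine) auto
      ultimately show ?thesis using \<epsilon>0[of k] by simp
    qed
    note L
    also have "(LINT \<xi>|lborel. F \<xi> * (LINT x|lborel. cis (x \<bullet> \<xi>) * G x))
        = (LINT \<xi>|lborel. F \<xi> * inverse (\<epsilon> k ^ DIM('a)) *\<^sub>R of_real (c * gauss ((\<xi> - \<xi>\<^sub>0) /\<^sub>R \<epsilon> k)))"
      unfolding inner ..
    \<comment> \<open>Substituting
      \<open>\<xi> = \<xi>\<^sub>0 + \<epsilon> k *\<^sub>R \<eta>\<close> produces the Jacobian
      \<epsilon>^n, which cancels the height.\<close>
    also have "\<dots>
        = \<bar>\<epsilon> k\<bar> ^ DIM('a) *\<^sub>R (LINT \<eta>|lborel. F (\<xi>\<^sub>0 + \<epsilon> k *\<^sub>R \<eta>) *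
            inverse (\<epsilon> k ^ DIM('a)) *\<^sub>R of_real (c * gauss ((\<xi>\<^sub>0 + \<epsilon> k *\<^sub>R \<eta> - \<xi>\<^sub>0) /\<^sub>R \<epsilon> k)))"
      using \<epsilon>0[of k] by (intro lborel_integral_affine) auto
    also have "\<dots> = (LINT \<eta>|lborel. of_real (c * gauss \<eta>) * F (\<xi>\<^sub>0 + \<epsilon> k *\<^sub>R \<eta>))"
      using \<epsilon>0[of k] by (simp add: mult_ac)
    finally show ?thesis .
  qed
  have "(\<lambda>k. LINT \<eta>|lborel. of_real (c * gauss \<eta>) * F (\<xi>\<^sub>0 + \<epsilon> k *\<^sub>R \<eta>))
      \<longlonglongrightarrow> (LINT \<eta>|lborel. of_real (c * gauss (\<eta>::'a)) * F \<xi>\<^sub>0)"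
  proof (rule integral_dominated_convergence[where w="\<lambda>\<eta>. c * gauss \<eta> * B"])
    show "AE \<eta> in lborel. (\<lambda>k. complex_of_real (c * gauss \<eta>) * F (\<xi>\<^sub>0 + \<epsilon> k *\<^sub>R \<eta>))
        \<longlonglongrightarrow> of_real (c * gauss \<eta>) * F \<xi>\<^sub>0"
    proof (intro AE_I2 tendsto_mult tendsto_const isCont_tendsto_compose[OF cont])
      fix \<eta> :: 'a
      have "(\<lambda>k. \<xi>\<^sub>0 + \<epsilon> k *\<^sub>R \<eta>) \<longlonglongrightarrow> \<xi>\<^sub>0 + 0 *\<^sub>R \<eta>" by (intro tendsto_intros \<epsilon>lim)
      then show "(\<lambda>k. \<xi>\<^sub>0 + \<epsilon> k *\<^sub>R \<eta>) \<longlonglongrightarrow> \<xi>\<^sub>0" by simp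
    qed
    show "AE \<eta> in lborel. norm (complex_of_real (c * gauss \<eta>) * F (\<xi>\<^sub>0 + \<epsilon> k *\<^sub>R \<eta>)) \<le> c * gauss \<eta> * B" for k
      using bd gauss_pos[where 'a='a]
      by (intro AE_I2) (simp add: norm_mult c_def abs_of_pos less_imp_le mult_left_mono)
  qed (auto intro!: integrable_mult_left integrable_mult_right integrable_gauss)
  also have "(LINT \<eta>|lborel. of_real (c * gauss (\<eta>::'a)) * F \<xi>\<^sub>0) = of_real ((2 * pi) ^ DIM('a)) * F \<xi>\<^sub>0"
  proof -
    \<comment> \<open>One factor (2 pi)^(n/2) comes from transforming the Gaussian, the other from
      integrating it.\<close>
    have "c * c = (2 * pi) ^ DIM('a)"
      by (simp add: c_def powr_add[symmetric] powr_realpow)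
    then have "(LINT \<eta>|lborel. c * gauss (\<eta>::'a)) = (2 * pi) ^ DIM('a)"
      by (simp add: integral_gauss c_def[symmetric])
    then show ?thesis by (simp only: integral_mult_left_zero integral_complex_of_real)
  qed
  finally show ?thesis unfolding L_eq[symmetric] by (rule LIMSEQ_unique[OF lim])
qed

text \<open>The two unitary factors (2 pi)^(-n/2) cancel the (2 pi)^n of the unnormalised
  formula.\<close>

theorem fourier_inverse_fourier:
  fixes F :: "real^'n::finite \<Rightarrow> complex"
  assumes "integrable lborel F" "\<And>\<xi>. norm (F \<xi>) \<le> B" "isCont F \<xi>"
    and int: "integrable lborel (inverse_fourier F)"
  shows "fourier (inverse_fourier F) \<xi> = F \<xi>"
proof -
  define c where "c = (2 * pi) powr (- real CARD('n) / 2)"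
  have c: "c > 0" by (simp add: c_def)
  define f where "f = (\<lambda>x. LINT \<xi>|lborel. cis (x \<bullet> \<xi>) * F \<xi>)"
  have inv: "inverse_fourier F = (\<lambda>x. c *\<^sub>R f x)"
    by (simp add: inverse_fourier_def f_def c_def fun_eq_iff)
  have cc: "c * c * (2 * pi) ^ CARD('n) = 1"
  proof -
    have "(2 * pi) ^ CARD('n) = (2 * pi) powr real CARD('n)" by (rule powr_realpow[symmetric]) simp
    then show ?thesis by (simp only: c_def powr_add[symmetric]) simp
  qed
  have "integrable lborel f"
    using integrable_scaleR_right[OF int, of "inverse c"] c by (simp add: inv)
  then have "(LINT x|lborel. cis (- (x \<bullet> \<xi>)) * f x) = of_real ((2 * pi) ^ CARD('n)) * F \<xi>"
    using fourier_inversion_unnormalised[OF assms(1-3) f_def] by simp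
  moreover have "fourier (inverse_fourier F) \<xi> = of_real (c * c) * (LINT x|lborel. cis (- (x \<bullet> \<xi>)) * f x)"
    unfolding inv fourier_def c_def[symmetric] by (simp add: scaleR_conv_of_real mult_ac)
  ultimately have "fourier (inverse_fourier F) \<xi> = of_real (c * c * (2 * pi) ^ CARD('n)) * F \<xi>"
    by simp
  then show ?thesis by (simp only: cc of_real_1 mult_1)
qed

section \<open>Fourier transforms of Schwartz functions\<close>

lemma schwartz_differentiable: "f \<in> schwartz \<Longrightarrow> f differentiable at x"
  unfolding schwartz_def using foldr.simps(1)[of partial_deriv] by (force dest: spec[of _ "[]"])

lemma schwartz_partial_deriv: "f \<in> schwartz \<Longrightarrow> partial_deriv i f \<in> schwartz"
proof -
  assume f: "f \<in> schwartz"
  \<comment> \<open>\<open>foldr\<close> applies the last list entry first, so a derivative taken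
    beforehand is appended at the end of the index list.\<close>
  have eq: "foldr partial_deriv is (partial_deriv i f) = foldr partial_deriv (is @ [i]) f" for "is"
    by simp
  show ?thesis
    unfolding schwartz_def mem_Collect_eq eq using f unfolding schwartz_def by blast
qed

lemma schwartz_iterated_partial_deriv: "f \<in> schwartz \<Longrightarrow> foldr partial_deriv is f \<in> schwartz"
  by (induction "is") (auto intro: schwartz_partial_deriv)

lemma schwartz_continuous: "f \<in> schwartz \<Longrightarrow> continuous_on UNIV f"
  by (meson schwartz_differentiable continuous_at_imp_continuous_on differentiable_imp_continuous_within)

lemma schwartz_measurable: "f \<in> schwartz \<Longrightarrow> f \<in> borel_measurable borel"
  by (intro borel_measurable_continuous_onI schwartz_continuous)

text \<open>With r = |x|^2, comparing r with 1 gives (1 + r)^N \<le> 2^N (1 + r^N). Two moments, of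
  orders 0 and 2 N, therefore control the full weight. This serves both for Schwartz functions and
  for their transforms.\<close>

lemma decay_from_moments:
  fixes x :: "'a::real_normed_vector"
  assumes "norm z \<le> A" "norm x ^ (2 * N) * norm z \<le> B"
  shows "norm z \<le> 2 ^ N * (A + B) * (1 + norm x ^ 2) powr (- real N)"
proof -
  let ?r = "norm x ^ 2"
  have pw: "(1 + ?r) powr (- real N) = inverse ((1 + ?r) ^ N)"
    by (simp add: powr_minus powr_realpow add_pos_nonneg)
  have "(1 + ?r) ^ N \<le> 2 ^ N * (1 + ?r ^ N)"
  proof (cases "?r \<le> 1")
    case True
    then have "(1 + ?r) ^ N \<le> 2 ^ N" by (intro power_mono) auto
    also have "\<dots> \<le> 2 ^ N * (1 + ?r ^ N)" by simp
    finally show ?thesis .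
  next
    case False
    then have "(1 + ?r) ^ N \<le> (2 * ?r) ^ N" by (intro power_mono) auto
    also have "\<dots> \<le> 2 ^ N * (1 + ?r ^ N)" by (simp add: power_mult_distrib)
    finally show ?thesis .
  qed
  then have "(1 + ?r) ^ N * norm z \<le> 2 ^ N * (1 + ?r ^ N) * norm z"
    by (rule mult_right_mono) simp
  also have "\<dots> = 2 ^ N * (norm z + norm x ^ (2 * N) * norm z)"
    by (simp add: algebra_simps power_mult[symmetric])
  also have "\<dots> \<le> 2 ^ N * (A + B)"
    using assms by (intro mult_left_mono add_mono) auto
  finally show ?thesis
    unfolding pw by (simp add: field_simps add_pos_nonneg)
qed

lemma schwartz_decay:
  assumes "f \<in> schwartz"
  obtains B where "B \<ge> 0" "\<And>x. norm (f x) \<le> B * (1 + norm x ^ 2) powr (- real N)"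
proof -
  have "bounded (range (\<lambda>x. norm x ^ M *\<^sub>R f x))" for M
    using assms unfolding schwartz_def by (force dest: spec[of _ "[]"])
  then have "\<exists>A. \<forall>x. norm x ^ M * norm (f x) \<le> A" for M
    unfolding bounded_iff by (auto simp: norm_power)
  then obtain A where A: "\<And>M x. norm x ^ M * norm (f x) \<le> A M" by metis
  have A0: "A M \<ge> 0" for M
    using A[of 0 M] by (rule order.trans[rotated]) simp
  have "norm (f x) \<le> 2 ^ N * (A 0 + A (2 * N)) * (1 + norm x ^ 2) powr (- real N)" for x
    using A[of x 0] A[of x "2 * N"] by (intro decay_from_moments) auto
  with A0 show thesis by (intro that[of "2 ^ N * (A 0 + A (2 * N))"]) auto
qed

lemma integrable_decaying:
  fixes f :: "'a::euclidean_space \<Rightarrow> complex"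
  assumes "f \<in> borel_measurable borel"
    and bd: "\<And>x. norm (f x) \<le> B * (1 + norm x ^ 2) powr (- real DIM('a))"
  shows "integrable lborel f"
proof (rule Bochner_Integration.integrable_bound)
  have "real DIM('a) > real DIM('a) / 2" by simp
  from integrable_mult_right[OF integrable_bessel_weight[OF this], of B]
  show "integrable lborel (\<lambda>x::'a. B * (1 + norm x ^ 2) powr (- real DIM('a)))" .
  show "AE x in lborel. norm (f x) \<le> norm (B * (1 + norm x ^ 2) powr (- real DIM('a)))"
    using bd by (intro AE_I2) (metis abs_ge_self order_trans real_norm_def)
qed (use assms in auto)

lemma schwartz_integrable:
  assumes "f \<in> schwartz"
  shows "integrable lborel f"
  using schwartz_decay[OF assms] schwartz_measurable[OF assms] integrable_decaying by metis

section \<open>Boundedness and continuity of the Fourier transform\<close>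

lemma integrable_cis_mult:
  fixes f :: "real^'n::finite \<Rightarrow> complex"
  assumes "integrable lborel f"
  shows "integrable lborel (\<lambda>x. cis (- (x \<bullet> \<xi>)) * f x)"
  using borel_measurable_integrable[OF assms]
  by (intro Bochner_Integration.integrable_bound[OF assms]) (auto simp: norm_mult)

lemma norm_fourier_le:
  fixes f :: "real^'n::finite \<Rightarrow> complex"
  shows "norm (fourier f \<xi>) \<le> (2 * pi) powr (- real CARD('n) / 2) * (LINT x|lborel. norm (f x))"
proof -
  have "norm (LINT x|lborel. cis (- (x \<bullet> \<xi>)) * f x) \<le> (LINT x|lborel. norm (cis (- (x \<bullet> \<xi>)) * f x))"
    by (rule integral_norm_bound)
  then show ?thesis by (simp add: fourier_def norm_mult mult_left_mono)
qed

lemma isCont_fourier: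
  fixes f :: "real^'n::finite \<Rightarrow> complex"
  assumes f: "integrable lborel f"
  shows "isCont (fourier f) \<xi>"
  unfolding continuous_at_sequentially comp_def
proof (intro allI impI)
  fix u assume u: "u \<longlonglongrightarrow> \<xi>"
  have [measurable]: "f \<in> borel_measurable borel"
    using borel_measurable_integrable[OF f] by simp
  have "(\<lambda>k. LINT x|lborel. cis (- (x \<bullet> u k)) * f x) \<longlonglongrightarrow> (LINT x|lborel. cis (- (x \<bullet> \<xi>)) * f x)"
  proof (rule integral_dominated_convergence[where w="\<lambda>x. norm (f x)"])
    show "AE x in lborel. (\<lambda>k. cis (- (x \<bullet> u k)) * f x) \<longlonglongrightarrow> cis (- (x \<bullet> \<xi>)) * f x"
      by (intro AE_I2 tendsto_intros u isCont_tendsto_compose[of _ cis])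
  qed (use f in \<open>auto simp: norm_mult\<close>)
  then show "(\<lambda>k. fourier f (u k)) \<longlonglongrightarrow> fourier f \<xi>"
    unfolding fourier_def by (intro tendsto_intros)
qed

lemma fourier_measurable [measurable]:
  fixes f :: "real^'n::finite \<Rightarrow> complex"
  assumes "integrable lborel f"
  shows "fourier f \<in> borel_measurable borel"
  by (intro borel_measurable_continuous_onI continuous_at_imp_continuous_on) (simp add: isCont_fourier assms)

section \<open>Fourier transforms of derivatives\<close>

lemma difference_quotient_cis:
  assumes "h \<longlonglongrightarrow> 0" "\<And>k. h k \<noteq> (0::real)"
  shows "(\<lambda>k. (cis (h k * s) - 1) / of_real (h k)) \<longlonglongrightarrow> \<i> * of_real s"
proof -
  have "((\<lambda>z. exp (z * (\<i> * of_real s))) has_field_derivative \<i> * of_real s) (at 0)"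
    by (auto intro!: derivative_eq_intros)
  then have "((\<lambda>z. (exp (z * (\<i> * of_real s)) - 1) / z) \<longlongrightarrow> \<i> * of_real s) (at 0)"
    unfolding has_field_derivative_iff by simp
  moreover have "filterlim (\<lambda>k. complex_of_real (h k)) (at 0) sequentially"
    unfolding filterlim_at using assms tendsto_of_real[OF assms(1), where 'a=complex] by simp
  ultimately have "(\<lambda>k. (exp (of_real (h k) * (\<i> * of_real s)) - 1) / of_real (h k)) \<longlonglongrightarrow> \<i> * of_real s"
    by (rule filterlim_compose)
  then show ?thesis by (simp add: cis_conv_exp mult_ac)
qed

lemma has_vector_derivative_along_axis:
  assumes "f \<in> schwartz"
  shows "((\<lambda>t. f (x + t *\<^sub>R axis i 1)) has_vector_derivative partial_deriv i f (x + t *\<^sub>R axis i 1)) (at t)"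
proof -
  have "(f has_derivative frechet_derivative f (at (x + t *\<^sub>R axis i 1))) (at (x + t *\<^sub>R axis i 1))"
    using schwartz_differentiable[OF assms] frechet_derivative_works by blast
  then have "((f \<circ> (\<lambda>t. x + t *\<^sub>R axis i 1)) has_derivative
      (frechet_derivative f (at (x + t *\<^sub>R axis i 1)) \<circ> (\<lambda>t. t *\<^sub>R axis i 1))) (at t)"
    by (intro diff_chain_at) (auto intro!: derivative_eq_intros)
  moreover have "linear (frechet_derivative f (at (x + t *\<^sub>R axis i 1)))"
    using schwartz_differentiable[OF assms] by (rule linear_frechet_derivative)
  ultimately show ?thesis
    by (simp add: has_vector_derivative_def comp_def partial_deriv_def linear_scale)
qed

text \<open>A majorant independent of \<open>h\<close>, used for dominated convergence. The mean
  value inequality on the segment reduces it to the decay of the partial derivative, and moving by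
  at most 1 changes the weight only by a constant factor.\<close>

lemma schwartz_difference_quotient_bound:
  fixes f :: "real^'n::finite \<Rightarrow> complex"
  assumes f: "f \<in> schwartz"
  obtains B where "B \<ge> 0" "\<And>x h. 0 < h \<Longrightarrow> h \<le> 1 \<Longrightarrow>
    norm ((f (x + h *\<^sub>R axis i 1) - f x) /\<^sub>R h) \<le> B * (1 + norm x ^ 2) powr (- real N)"
proof -
  obtain B where B: "B \<ge> 0" "\<And>x. norm (partial_deriv i f x) \<le> B * (1 + norm x ^ 2) powr (- real N)"
    using schwartz_decay[OF schwartz_partial_deriv[OF f]] by blast
  have "norm ((f (x + h *\<^sub>R axis i 1) - f x) /\<^sub>R h) \<le> 3 ^ N * B * (1 + norm x ^ 2) powr (- real N)"
    if h: "0 < h" "h \<le> 1" for x h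
  proof -
    let ?K = "3 ^ N * B * (1 + norm x ^ 2) powr (- real N)"
    \<comment> \<open>For |x - y| \<le> 1 one has |x|^2 \<le> 2 |y|^2 + 2, hence 1 + |x|^2 \<le> 3
      (1 + |y|^2); this is the origin of the factor 3^N.\<close>
    have third: "(1 + a) / 3 \<le> 1 + b" if "a \<le> 2 * b + 2" "0 \<le> b" for a b :: real
      using that by simp
    have bd: "norm (partial_deriv i f (x + t *\<^sub>R axis i 1)) \<le> ?K" if t: "0 < t" "t < h" for t
    proof -
      let ?y = "x + t *\<^sub>R axis i 1"
      have "norm x \<le> norm ?y + norm (- t *\<^sub>R axis i (1::real))"
        using norm_triangle_ineq[of ?y "- t *\<^sub>R axis i 1"] by simp
      then have "norm x \<le> norm ?y + 1" using t h by simp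
      then have "norm x ^ 2 \<le> (norm ?y + 1) ^ 2" by (intro power_mono) auto
      also have "\<dots> \<le> 2 * norm ?y ^ 2 + 2"
        using zero_le_power2[of "norm ?y - 1"] by (simp add: power2_eq_square algebra_simps)
      finally have "norm x ^ 2 \<le> 2 * norm ?y ^ 2 + 2" .
      then have "(1 + norm x ^ 2) / 3 \<le> 1 + norm ?y ^ 2"
        by (rule third) simp
      then have "(1 + norm ?y ^ 2) powr (- real N) \<le> ((1 + norm x ^ 2) / 3) powr (- real N)"
        by (intro powr_mono2') (auto simp: add_pos_nonneg)
      also have "\<dots> = 3 ^ N * (1 + norm x ^ 2) powr (- real N)"
        by (simp add: powr_divide powr_minus powr_realpow add_nonneg_nonneg field_simps)
      finally show ?thesis
        using B(2)[of ?y] B(1) mult_left_mono[OF _ B(1)] by (fastforce simp: mult_ac)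
    qed
    have "norm (f (x + h *\<^sub>R axis i 1) - f (x + 0 *\<^sub>R axis i 1)) \<le> h * ?K - 0 * ?K"
    proof (rule differentiable_bound_general[where f'="\<lambda>t. partial_deriv i f (x + t *\<^sub>R axis i 1)" and \<phi>'="\<lambda>_. ?K"])
      show "continuous_on {0..h} (\<lambda>t. f (x + t *\<^sub>R axis i 1))"
        by (intro continuous_on_compose2[OF schwartz_continuous[OF f]] continuous_intros) auto
    qed (use h bd in \<open>auto intro!: has_vector_derivative_along_axis[OF f] derivative_eq_intros continuous_intros\<close>)
    moreover have "norm ((f (x + h *\<^sub>R axis i 1) - f x) /\<^sub>R h) = norm (f (x + h *\<^sub>R axis i 1) - f x) / h"
      using h by (simp add: divide_inverse_commute)
    ultimately show ?thesis using h by (simp add: pos_divide_le_eq mult.commute)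
  qed
  with B(1) show thesis by (intro that[of "3 ^ N * B"]) auto
qed

text \<open>Difference quotients replace integration by parts. The transform of a translate differs
  by a phase, so the transform of the difference quotient is (cis(h \<xi>_i) - 1) / h times that of
  \<open>f\<close>; both sides are then passed to the limit h to 0.\<close>

lemma fourier_partial_deriv:
  fixes f :: "real^'n::finite \<Rightarrow> complex"
  assumes f: "f \<in> schwartz"
  shows "fourier (partial_deriv i f) \<xi> = \<i> * of_real (\<xi> $ i) * fourier f \<xi>"
proof -
  note [measurable] = schwartz_measurable[OF f] schwartz_measurable[OF schwartz_partial_deriv[OF f]]
  let ?e = "axis i 1 :: real^'n"
  define I where "I = (LINT x|lborel. cis (- (x \<bullet> \<xi>)) * f x)"
  define h where "h k = inverse (real (Suc k))" for k
  have h0: "h k > 0" "h k \<le> 1" "h k \<noteq> 0" for k by (auto simp: h_def inverse_le_1_iff)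
  have hlim: "h \<longlonglongrightarrow> 0" unfolding h_def by (rule LIMSEQ_inverse_real_of_nat)
  define Q where "Q k x = (f (x + h k *\<^sub>R ?e) - f x) /\<^sub>R h k" for k x
  obtain B where B: "\<And>x h. 0 < h \<Longrightarrow> h \<le> 1 \<Longrightarrow>
    norm ((f (x + h *\<^sub>R axis i 1) - f x) /\<^sub>R h) \<le> B * (1 + norm x ^ 2) powr (- real CARD('n))"
    using schwartz_difference_quotient_bound[OF f] by metis
  have "(\<lambda>k. LINT x|lborel. cis (- (x \<bullet> \<xi>)) * Q k x)
      \<longlonglongrightarrow> (LINT x|lborel. cis (- (x \<bullet> \<xi>)) * partial_deriv i f x)"
  proof (rule integral_dominated_convergence[where w="\<lambda>x. B * (1 + norm x ^ 2) powr (- real CARD('n))"])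
    have "(\<lambda>k. Q k x) \<longlonglongrightarrow> partial_deriv i f x" for x
    proof -
      have "((\<lambda>t. f (x + t *\<^sub>R ?e)) has_vector_derivative partial_deriv i f (x + 0 *\<^sub>R ?e)) (at 0)"
        by (rule has_vector_derivative_along_axis[OF f])
      then have "((\<lambda>t. norm (f (x + t *\<^sub>R ?e) - f x - t *\<^sub>R partial_deriv i f x) / norm t) \<longlongrightarrow> 0) (at 0)"
        by (simp add: has_vector_derivative_def has_derivative_at)
      also have "(\<lambda>t. norm (f (x + t *\<^sub>R ?e) - f x - t *\<^sub>R partial_deriv i f x) / norm t)
          = (\<lambda>t. norm ((f (x + t *\<^sub>R ?e) - f x - t *\<^sub>R partial_deriv i f x) /\<^sub>R t))"
        by (simp add: divide_inverse_commute)
      finally have "((\<lambda>t. (f (x + t *\<^sub>R ?e) - f x - t *\<^sub>R partial_deriv i f x) /\<^sub>R t) \<longlongrightarrow> 0) (at 0)"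
        by (rule tendsto_norm_zero_cancel)
      then have "((\<lambda>t. (f (x + t *\<^sub>R ?e) - f x) /\<^sub>R t - partial_deriv i f x) \<longlongrightarrow> 0) (at 0)"
        by (rule Lim_transform_within[where d=1]) (auto simp: scaleR_diff_right)
      then have "((\<lambda>t. (f (x + t *\<^sub>R ?e) - f x) /\<^sub>R t) \<longlongrightarrow> partial_deriv i f x) (at 0)"
        by (simp add: Lim_null[symmetric])
      moreover have "filterlim h (at 0) sequentially"
        unfolding filterlim_at using hlim h0 by simp
      ultimately show ?thesis unfolding Q_def by (rule filterlim_compose)
    qed
    then show "AE x in lborel. (\<lambda>k. cis (- (x \<bullet> \<xi>)) * Q k x) \<longlonglongrightarrow> cis (- (x \<bullet> \<xi>)) * partial_deriv i f x"
      by (intro AE_I2 tendsto_intros)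
    show "AE x in lborel. norm (cis (- (x \<bullet> \<xi>)) * Q k x) \<le> B * (1 + norm x ^ 2) powr (- real CARD('n))" for k
      using B[OF h0(1,2)] by (simp add: norm_mult Q_def)
    show "integrable lborel (\<lambda>x::real^'n. B * (1 + norm x ^ 2) powr (- real CARD('n)))"
      by (intro integrable_mult_right integrable_bessel_weight) simp
  qed (simp_all add: Q_def)
  moreover have "(LINT x|lborel. cis (- (x \<bullet> \<xi>)) * Q k x) = (cis (h k * \<xi> $ i) - 1) / of_real (h k) * I" for k
  proof -
    have quot: "cis (- (x \<bullet> \<xi>)) * f (h k *\<^sub>R ?e + 1 *\<^sub>R x) - cis (- (x \<bullet> \<xi>)) * f x
        = of_real (h k) * (cis (- (x \<bullet> \<xi>)) * Q k x)" for x
      using h0(1)[of k] by (simp add: Q_def scaleR_conv_of_real field_simps)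
    \<comment> \<open>Translation invariance moves the shift into the phase, from which the factor
      cis(h \<xi>_i) splits off.\<close>
    have translate: "I = (LINT x|lborel. cis (- ((h k *\<^sub>R ?e + 1 *\<^sub>R x) \<bullet> \<xi>)) * f (h k *\<^sub>R ?e + 1 *\<^sub>R x))"
      unfolding I_def by (subst lborel_integral_affine[where c=1 and a="h k *\<^sub>R ?e"]) auto
    have int: "integrable lborel (\<lambda>x. cis (- (x \<bullet> \<xi>)) * f (h k *\<^sub>R ?e + 1 *\<^sub>R x))"
      by (intro integrable_cis_mult lborel_integrable_affine schwartz_integrable f) simp
    have "cis (h k * \<xi> $ i) * I = (LINT x|lborel. cis (h k * \<xi> $ i) *
        (cis (- ((h k *\<^sub>R ?e + 1 *\<^sub>R x) \<bullet> \<xi>)) * f (h k *\<^sub>R ?e + 1 *\<^sub>R x)))"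
      unfolding translate by simp
    also have "\<dots> = (LINT x|lborel. cis (- (x \<bullet> \<xi>)) * f (h k *\<^sub>R ?e + 1 *\<^sub>R x))"
      by (simp add: mult.assoc[symmetric] cis_mult inner_add_left inner_axis')
    finally have "(cis (h k * \<xi> $ i) - 1) * I
        = (LINT x|lborel. cis (- (x \<bullet> \<xi>)) * f (h k *\<^sub>R ?e + 1 *\<^sub>R x)) - I"
      by (simp add: algebra_simps)
    also have "\<dots> = (LINT x|lborel. cis (- (x \<bullet> \<xi>)) * f (h k *\<^sub>R ?e + 1 *\<^sub>R x) - cis (- (x \<bullet> \<xi>)) * f x)"
      unfolding I_def
      by (rule Bochner_Integration.integral_diff[symmetric, OF int integrable_cis_mult[OF schwartz_integrable[OF f]]])
    also have "\<dots> = (LINT x|lborel. of_real (h k) * (cis (- (x \<bullet> \<xi>)) * Q k x))"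
      unfolding quot ..
    also have "\<dots> = of_real (h k) * (LINT x|lborel. cis (- (x \<bullet> \<xi>)) * Q k x)" by simp
    finally show ?thesis using h0(1)[of k] by (simp add: field_simps)
  qed
  moreover have "(\<lambda>k. (cis (h k * \<xi> $ i) - 1) / of_real (h k) * I) \<longlonglongrightarrow> \<i> * of_real (\<xi> $ i) * I"
    by (intro tendsto_intros difference_quotient_cis hlim h0)
  ultimately have "(LINT x|lborel. cis (- (x \<bullet> \<xi>)) * partial_deriv i f x) = \<i> * of_real (\<xi> $ i) * I"
    using LIMSEQ_unique by simp
  then show ?thesis by (simp add: fourier_def I_def)
qed

lemma fourier_laplacian:
  fixes f :: "real^'n::finite \<Rightarrow> complex"
  assumes f: "f \<in> schwartz"
  shows "fourier (laplacian f) \<xi> = - of_real (norm \<xi> ^ 2) * fourier f \<xi>"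
proof -
  have "fourier (laplacian f) \<xi> = (\<Sum>i\<in>UNIV. fourier (partial_deriv i (partial_deriv i f)) \<xi>)"
    unfolding fourier_def laplacian_def sum_distrib_left scaleR_sum_right[symmetric]
    by (subst Bochner_Integration.integral_sum)
      (simp_all add: integrable_cis_mult[OF schwartz_integrable[OF schwartz_partial_deriv[OF schwartz_partial_deriv[OF f]]]])
  also have "\<dots> = (\<Sum>i\<in>UNIV. - of_real ((\<xi> $ i)\<^sup>2) * fourier f \<xi>)"
    by (intro sum.cong refl)
      (simp add: fourier_partial_deriv schwartz_partial_deriv f power2_eq_square mult_ac)
  also have "\<dots> = - of_real (\<Sum>i\<in>UNIV. (\<xi> $ i)\<^sup>2) * fourier f \<xi>"
    by (simp add: sum_distrib_right sum_negf)
  also have "(\<Sum>i\<in>UNIV. (\<xi> $ i)\<^sup>2) = norm \<xi> ^ 2"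
    unfolding power2_norm_eq_inner inner_vec_def by (simp add: power2_eq_square)
  finally show ?thesis .
qed

text \<open>Differentiating 2 N times in direction i multiplies the transform by (\<i> \<xi>_i)^(2
  N), and the transform of an integrable function is bounded. Since |\<xi>|^2 is at most n times its
  largest squared coordinate, this bounds the moment of order 2 N.\<close>

lemma fourier_decay:
  fixes f :: "real^'n::finite \<Rightarrow> complex"
  assumes f: "f \<in> schwartz"
  obtains B where "\<And>\<xi>. norm (fourier f \<xi>) \<le> B * (1 + norm \<xi> ^ 2) powr (- real N)"
proof -
  define D where "D i = foldr partial_deriv (replicate (2 * N) i) f" for i
  have pow: "fourier (foldr partial_deriv (replicate M i) f) \<xi> = (\<i> * of_real (\<xi> $ i)) ^ M * fourier f \<xi>" for M i \<xi>
    by (induction M) (simp_all add: fourier_partial_deriv[OF schwartz_iterated_partial_deriv[OF f]] del: foldr_replicate)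
  define c where "c g = (2 * pi) powr (- real CARD('n) / 2) * (LINT x|lborel. norm (g x))" for g :: "real^'n \<Rightarrow> complex"
  have c0: "c g \<ge> 0" for g by (simp add: c_def)
  \<comment> \<open>The direction of the largest coordinate varies with \<xi>; the sum over all
    directions is a bound free of that choice.\<close>
  define A where "A = real CARD('n) ^ N * (\<Sum>i\<in>UNIV. c (D i))"
  have "norm \<xi> ^ (2 * N) * norm (fourier f \<xi>) \<le> A" for \<xi>
  proof -
    have "\<exists>j\<in>UNIV. \<forall>i\<in>UNIV. (\<xi> $ i)\<^sup>2 \<le> (\<xi> $ j)\<^sup>2"
      using Max_in[of "range (\<lambda>i. (\<xi> $ i)\<^sup>2)"] Max_ge[of "range (\<lambda>i. (\<xi> $ i)\<^sup>2)"] by fastforce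
    then obtain j where j: "(\<xi> $ i)\<^sup>2 \<le> (\<xi> $ j)\<^sup>2" for i by auto
    have "norm \<xi> ^ 2 = (\<Sum>i\<in>UNIV. (\<xi> $ i)\<^sup>2)"
      unfolding power2_norm_eq_inner inner_vec_def by (simp add: power2_eq_square)
    also have "\<dots> \<le> real CARD('n) * (\<xi> $ j)\<^sup>2"
      using sum_bounded_above[of UNIV "\<lambda>i. (\<xi> $ i)\<^sup>2" "(\<xi> $ j)\<^sup>2"] j by simp
    finally have "(norm \<xi> ^ 2) ^ N \<le> (real CARD('n) * (\<xi> $ j)\<^sup>2) ^ N"
      by (intro power_mono) auto
    then have "norm \<xi> ^ (2 * N) * norm (fourier f \<xi>)
        \<le> (real CARD('n) * (\<xi> $ j)\<^sup>2) ^ N * norm (fourier f \<xi>)"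
      by (simp add: power_mult mult_right_mono)
    also have "\<dots> = real CARD('n) ^ N * norm (fourier (D j) \<xi>)"
      unfolding D_def pow by (simp add: norm_mult norm_power power_mult_distrib power_mult)
    also have "\<dots> \<le> real CARD('n) ^ N * c (D j)"
      unfolding c_def by (intro mult_left_mono norm_fourier_le) simp
    also have "\<dots> \<le> A"
      unfolding A_def by (intro mult_left_mono member_le_sum) (auto simp: c0)
    finally show ?thesis .
  qed
  then have "norm (fourier f \<xi>) \<le> 2 ^ N * (c f + A) * (1 + norm \<xi> ^ 2) powr (- real N)" for \<xi>
    using norm_fourier_le[of f \<xi>] by (intro decay_from_moments) (auto simp: c_def)
  then show thesis by (rule that)
qed

section \<open>Bounds for multiplier operators\<close>

lemma L2_norm_square: "L2_norm f ^ 2 = (\<integral>\<^sup>+ x. ennreal (norm (f x) ^ 2) \<partial>lborel)"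
proof (cases "(\<integral>\<^sup>+ x. ennreal (norm (f x) ^ 2) \<partial>lborel) = \<infinity>")
  case False
  then show ?thesis
    by (simp add: L2_norm_def Let_def ennreal_power less_top)
qed (simp add: L2_norm_def Let_def)

lemma ennreal_power2_le_imp_le:
  fixes x y :: ennreal
  assumes "x ^ 2 \<le> y ^ 2"
  shows "x \<le> y"
proof (cases x y rule: ennreal2_cases)
  case (real_real a b)
  with assms show ?thesis by (auto simp: ennreal_power intro!: ennreal_leI power2_le_imp_le)
qed (use assms in \<open>auto simp: ennreal_power top_unique\<close>)

lemma L2_norm_mono:
  assumes [measurable]: "g \<in> borel_measurable borel" and K: "K \<ge> 0"
    and le: "\<And>x. norm (f x) \<le> K * norm (g x)"
  shows "L2_norm f \<le> ennreal K * L2_norm g"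
proof (rule ennreal_power2_le_imp_le)
  have "L2_norm f ^ 2 \<le> (\<integral>\<^sup>+ x. ennreal (K ^ 2) * ennreal (norm (g x) ^ 2) \<partial>lborel)"
    unfolding L2_norm_square using K power_mono[OF le, of _ 2]
    by (intro nn_integral_mono) (simp add: ennreal_mult[symmetric] power_mult_distrib ennreal_leI)
  also have "\<dots> = (ennreal K * L2_norm g) ^ 2"
    using K by (subst nn_integral_cmult) (auto simp: L2_norm_square power_mult_distrib ennreal_power)
  finally show "L2_norm f ^ 2 \<le> (ennreal K * L2_norm g) ^ 2" .
qed

text \<open>The phase has modulus 1 and is invertible, so \<open>f\<close> is integrable as soon as
  its product with the phase is. Otherwise the Bochner integral takes its default value 0.\<close>

lemma fourier_not_integrable:
  assumes "\<not> integrable lborel f"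
  shows "fourier f \<xi> = 0"
proof -
  have "integrable lborel f" if int: "integrable lborel (\<lambda>x. cis (- (x \<bullet> \<xi>)) * f x)"
  proof -
    note [measurable] = borel_measurable_integrable[OF int]
    have eq: "f x = cis (x \<bullet> \<xi>) * (cis (- (x \<bullet> \<xi>)) * f x)" for x
      by (simp add: mult.assoc[symmetric] cis_mult)
    have "(\<lambda>x. cis (x \<bullet> \<xi>) * (cis (- (x \<bullet> \<xi>)) * f x)) \<in> borel_measurable lborel"
      by measurable
    then have "f \<in> borel_measurable lborel" unfolding eq[symmetric] .
    then show ?thesis
      by (intro Bochner_Integration.integrable_bound[OF int]) (auto simp: norm_mult)
  qed
  with assms have "(LINT x|lborel. cis (- (x \<bullet> \<xi>)) * f x) = 0"
    by (intro not_integrable_integral_eq) blast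
  then show ?thesis by (simp add: fourier_def)
qed

lemma multiplier_decay:
  fixes g :: "real^'n::finite \<Rightarrow> complex"
  assumes g: "g \<in> schwartz" and q: "continuous_on UNIV q"
    and bd: "\<And>\<xi>. \<bar>q \<xi>\<bar> \<le> K * (1 + norm \<xi> ^ 2) powr (\<delta> / 2)" and K: "K \<ge> 0" and \<delta>: "\<delta> \<le> 2"
  shows multiplier_integrable: "integrable lborel (\<lambda>\<xi>. of_real (q \<xi>) * fourier g \<xi>)"
    and multiplier_bounded: "\<exists>B. \<forall>\<xi>. norm (of_real (q \<xi>) * fourier g \<xi>) \<le> B"
proof -
  note [measurable] = fourier_measurable[OF schwartz_integrable[OF g]]
    borel_measurable_continuous_onI[OF q]
  let ?n = "CARD('n)"
  \<comment> \<open>The exponent is one more than the dimension: the growth of \<open>q\<close> with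
    \<open>\<delta> \<le> 2\<close> costs at most one power of 1 + |\<xi>|^2, and the remaining
    exponent n is still integrable.\<close>
  obtain B where B: "\<And>\<xi>. norm (fourier g \<xi>) \<le> B * (1 + norm \<xi> ^ 2) powr (- real (?n + 1))"
    using fourier_decay[OF g] by metis
  have B0: "B \<ge> 0" using order.trans[OF norm_ge_zero B[of 0]] by simp
  have le: "norm (of_real (q \<xi>) * fourier g \<xi>) \<le> (K * B) * (1 + norm \<xi> ^ 2) powr (- real ?n)" for \<xi>
  proof -
    have "(1 + norm \<xi> ^ 2) powr (\<delta> / 2) \<le> (1 + norm \<xi> ^ 2) powr 1"
      by (rule powr_mono) (use \<delta> in auto)
    then have "\<bar>q \<xi>\<bar> \<le> K * (1 + norm \<xi> ^ 2) powr 1"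
      using bd[of \<xi>] K by (meson mult_left_mono order_trans)
    then have "norm (of_real (q \<xi>) * fourier g \<xi>)
        \<le> (K * (1 + norm \<xi> ^ 2) powr 1) * (B * (1 + norm \<xi> ^ 2) powr (- real (?n + 1)))"
      unfolding norm_mult norm_of_real by (intro mult_mono B) (use K in auto)
    also have "\<dots> = (K * B) * ((1 + norm \<xi> ^ 2) powr 1 * (1 + norm \<xi> ^ 2) powr (- real (?n + 1)))"
      by (simp only: mult_ac)
    also have "(1 + norm \<xi> ^ 2) powr 1 * (1 + norm \<xi> ^ 2) powr (- real (?n + 1)) = (1 + norm \<xi> ^ 2) powr (- real ?n)"
      unfolding powr_add[symmetric] by simp
    finally show ?thesis .
  qed
  then show "integrable lborel (\<lambda>\<xi>. of_real (q \<xi>) * fourier g \<xi>)"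
    by (intro integrable_decaying[where B="K * B"]) simp_all
  have "(1 + norm \<xi> ^ 2) powr (- real ?n) \<le> 1" for \<xi> :: "real^'n"
    using powr_mono2'[of "- real ?n" 1 "1 + norm \<xi> ^ 2"] by simp
  then have "norm (of_real (q \<xi>) * fourier g \<xi>) \<le> K * B" for \<xi>
    using le[of \<xi>] mult_left_mono[of "(1 + norm \<xi> ^ 2) powr (- real ?n)" 1 "K * B"] K B0 by fastforce
  then show "\<exists>B. \<forall>\<xi>. norm (of_real (q \<xi>) * fourier g \<xi>) \<le> B" by blast
qed

text \<open>A symbol of order \<delta> costs \<delta> derivatives: its growth is exactly compensated
  by lowering the Sobolev weight from s to s - \<delta>.\<close>

lemma sobolev_norm_multiplier_le:
  fixes g :: "real^'n::finite \<Rightarrow> complex"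
  assumes g: "g \<in> schwartz" and q: "continuous_on UNIV q"
    and bd: "\<And>\<xi>. \<bar>q \<xi>\<bar> \<le> K * (1 + norm \<xi> ^ 2) powr (\<delta> / 2)" and K: "K \<ge> 0" and \<delta>: "\<delta> \<le> 2"
  shows "sobolev_norm (s - \<delta>) (inverse_fourier (\<lambda>\<xi>. of_real (q \<xi>) * fourier g \<xi>))
    \<le> ennreal K * sobolev_norm s g"
proof -
  note [measurable] = fourier_measurable[OF schwartz_integrable[OF g]]
  let ?F = "\<lambda>\<xi>. of_real (q \<xi>) * fourier g \<xi>"
  \<comment> \<open>An inequality suffices: if the inverse transform is not integrable, then \<^const>\<open>fourier\<close> returns the
    default value \<open>0\<close> of the Bochner integral.\<close>
  have le: "norm (fourier (inverse_fourier ?F) \<xi>) \<le> norm (?F \<xi>)" for \<xi>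
  proof (cases "integrable lborel (inverse_fourier ?F)")
    case True
    obtain B where B: "\<And>\<xi>. norm (?F \<xi>) \<le> B" using multiplier_bounded[OF assms] by blast
    have "isCont ?F \<xi>"
      using q by (intro continuous_intros isCont_fourier schwartz_integrable g)
        (simp add: continuous_on_eq_continuous_at)
    from fourier_inverse_fourier[OF multiplier_integrable[OF assms] B this True]
    show ?thesis by simp
  qed (simp add: fourier_not_integrable)
  show ?thesis
    unfolding sobolev_norm_def
  proof (rule L2_norm_mono)
    fix \<xi> :: "real^'n"
    let ?J = "1 + norm \<xi> ^ 2"
    have "norm (?J powr ((s - \<delta>) / 2) *\<^sub>R fourier (inverse_fourier ?F) \<xi>) \<le> ?J powr ((s - \<delta>) / 2) * norm (?F \<xi>)"
      using le by (simp add: mult_left_mono)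
    also have "\<dots> \<le> ?J powr ((s - \<delta>) / 2) * ((K * ?J powr (\<delta> / 2)) * norm (fourier g \<xi>))"
      unfolding norm_mult norm_of_real by (intro mult_left_mono mult_right_mono bd) auto
    also have "\<dots> = K * ((?J powr ((s - \<delta>) / 2) * ?J powr (\<delta> / 2)) * norm (fourier g \<xi>))"
      by (simp only: mult_ac)
    also have "?J powr ((s - \<delta>) / 2) * ?J powr (\<delta> / 2) = ?J powr (s / 2)"
      by (simp add: powr_add[symmetric] diff_divide_distrib)
    finally show "norm (?J powr ((s - \<delta>) / 2) *\<^sub>R fourier (inverse_fourier ?F) \<xi>)
        \<le> K * norm (?J powr (s / 2) *\<^sub>R fourier g \<xi>)" by simp
  qed (use K in measurable)
qed

section \<open>The supremum bound from low and high frequencies\<close>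

lemma integral_dilated_gauss:
  assumes "c > 0"
  shows "integrable lborel (\<lambda>x. gauss (c *\<^sub>R x :: 'a::euclidean_space))"
    and "(LINT x|lborel. gauss (c *\<^sub>R x :: 'a)) = (2 * pi) powr (real DIM('a) / 2) * c powr (- real DIM('a))"
proof -
  show "integrable lborel (\<lambda>x. gauss (c *\<^sub>R x :: 'a))"
    using lborel_integrable_affine[OF integrable_gauss, of c "0::'a"] assms by simp
  have "(2 * pi) powr (real DIM('a) / 2) = c ^ DIM('a) * (LINT x|lborel. gauss (c *\<^sub>R x :: 'a))"
    using lborel_integral_affine[of "gauss :: 'a \<Rightarrow> real" c 0] assms by (simp add: integral_gauss)
  then show "(LINT x|lborel. gauss (c *\<^sub>R x :: 'a)) = (2 * pi) powr (real DIM('a) / 2) * c powr (- real DIM('a))"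
    using assms by (simp add: powr_minus powr_realpow field_simps)
qed

text \<open>Cauchy-Schwarz after splitting the exponent \<delta> / 2 as -s / 2 + (s + \<delta>) / 2;
  the first factor is square integrable because s > n / 2.\<close>

lemma nn_integral_fourier_weighted_le:
  fixes g :: "real^'n::finite \<Rightarrow> complex"
  assumes g: "g \<in> schwartz" and s: "s > real CARD('n) / 2"
  shows "(\<integral>\<^sup>+ \<xi>. ennreal ((1 + norm \<xi> ^ 2) powr (\<delta> / 2) * norm (fourier g \<xi>)) \<partial>lborel)
    \<le> ennreal (sqrt (LINT \<xi>::real^'n|lborel. (1 + norm \<xi> ^ 2) powr (- s))) * sobolev_norm (s + \<delta>) g"
proof (rule ennreal_power2_le_imp_le)
  note [measurable] = fourier_measurable[OF schwartz_integrable[OF g]]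
  let ?J = "\<lambda>\<xi>::real^'n. 1 + norm \<xi> ^ 2"
  let ?f = "\<lambda>\<xi>. ennreal (?J \<xi> powr (- s / 2))"
  let ?w = "\<lambda>\<xi>. ?J \<xi> powr ((s + \<delta>) / 2) *\<^sub>R fourier g \<xi>"
  have sp: "?J \<xi> powr (\<delta> / 2) * norm (fourier g \<xi>) = ?J \<xi> powr (- s / 2) * norm (?w \<xi>)" for \<xi>
    by (simp add: mult.assoc[symmetric] powr_add[symmetric] add_divide_distrib)
  have sq: "?f \<xi> ^ 2 = ennreal (?J \<xi> powr (- s))" for \<xi>
    unfolding power2_eq_square[of "?f \<xi>"] by (simp add: ennreal_mult[symmetric] powr_add[symmetric])
  have "(\<integral>\<^sup>+ \<xi>. ennreal (?J \<xi> powr (\<delta> / 2) * norm (fourier g \<xi>)) \<partial>lborel) ^ 2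
      = (\<integral>\<^sup>+ \<xi>. ?f \<xi> * ennreal (norm (?w \<xi>)) \<partial>lborel) ^ 2"
    unfolding sp by (simp add: ennreal_mult)
  also have "\<dots> \<le> (\<integral>\<^sup>+ \<xi>. ?f \<xi> ^ 2 \<partial>lborel) * (\<integral>\<^sup>+ \<xi>. ennreal (norm (?w \<xi>)) ^ 2 \<partial>lborel)"
    by (rule Cauchy_Schwarz_nn_integral) measurable
  also have "(\<integral>\<^sup>+ \<xi>. ?f \<xi> ^ 2 \<partial>lborel) = ennreal (LINT \<xi>|lborel. ?J \<xi> powr (- s))"
    unfolding sq by (intro nn_integral_eq_integral integrable_bessel_weight) (use s in auto)
  also have "\<dots> = ennreal (sqrt (LINT \<xi>|lborel. ?J \<xi> powr (- s))) ^ 2"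
    by (simp add: ennreal_power integral_nonneg_AE)
  also have "(\<integral>\<^sup>+ \<xi>. ennreal (norm (?w \<xi>)) ^ 2 \<partial>lborel) = sobolev_norm (s + \<delta>) g ^ 2"
    unfolding sobolev_norm_def L2_norm_square by (simp add: ennreal_power)
  finally show "(\<integral>\<^sup>+ \<xi>. ennreal (?J \<xi> powr (\<delta> / 2) * norm (fourier g \<xi>)) \<partial>lborel) ^ 2
      \<le> (ennreal (sqrt (LINT \<xi>|lborel. ?J \<xi> powr (- s))) * sobolev_norm (s + \<delta>) g) ^ 2"
    by (simp add: power_mult_distrib)
qed

lemma Linf_norm_inverse_fourier_le:
  fixes F :: "real^'n::finite \<Rightarrow> complex"
  assumes F: "integrable lborel F"
  shows "Linf_norm (inverse_fourier F)
    \<le> ennreal ((2 * pi) powr (- real CARD('n) / 2)) * (\<integral>\<^sup>+ \<xi>. ennreal (norm (F \<xi>)) \<partial>lborel)"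
  unfolding Linf_norm_def
proof (rule esssup_I)
  \<comment> \<open>Measurability is inherited from the Fourier transform through the reflection of
    the argument.\<close>
  have "inverse_fourier F = (\<lambda>x. fourier F (- x))"
    by (simp add: fun_eq_iff inverse_fourier_def fourier_def inner_commute)
  then show "(\<lambda>x. ennreal (norm (inverse_fourier F x))) \<in> borel_measurable lborel"
    using fourier_measurable[OF F] by simp
  have "ennreal (norm (inverse_fourier F x))
      \<le> ennreal ((2 * pi) powr (- real CARD('n) / 2)) * (\<integral>\<^sup>+ \<xi>. ennreal (norm (F \<xi>)) \<partial>lborel)" for x
  proof -
    have int: "integrable lborel (\<lambda>\<xi>. cis (x \<bullet> \<xi>) * F \<xi>)"
      using integrable_cis_mult[OF F, of "- x"] by (simp add: inner_commute)
    have "ennreal (norm (LINT \<xi>|lborel. cis (x \<bullet> \<xi>) * F \<xi>)) \<le> (\<integral>\<^sup>+ \<xi>. ennreal (norm (F \<xi>)) \<partial>lborel)"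
      using integral_norm_bound_ennreal[OF int] by (simp add: norm_mult)
    then show ?thesis
      by (simp add: inverse_fourier_def ennreal_mult mult_left_mono)
  qed
  then show "AE x in lborel. ennreal (norm (inverse_fourier F x))
      \<le> ennreal ((2 * pi) powr (- real CARD('n) / 2)) * (\<integral>\<^sup>+ \<xi>. ennreal (norm (F \<xi>)) \<partial>lborel)" by simp
qed

lemma L1_norm_eq:
  assumes "integrable lborel g"
  shows "L1_norm g = ennreal (LINT x|lborel. norm (g x))"
  unfolding L1_norm_def using assms by (intro nn_integral_eq_integral) auto

text \<open>The supremum is bounded by the L1 norm of the multiplied transform. For |\<xi>| \<le> 1
  the damping is majorised by a Gaussian in \<xi>; for |\<xi>| > 1 it is at most exp(-t / 4). The
  coefficient of the L1 term is free of \<open>s\<close>, as the final choice of constants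
  requires.\<close>

lemma Linf_norm_multiplier_le:
  fixes g :: "real^'n::finite \<Rightarrow> complex"
  assumes g: "g \<in> schwartz" and q: "continuous_on UNIV q" and \<delta>: "0 \<le> \<delta>" "\<delta> \<le> 2"
    and K: "K \<ge> 0" and t: "t > 0" and s: "s > real CARD('n) / 2"
    and bd: "\<And>\<xi>. \<bar>q \<xi>\<bar> \<le> K * exp (- (norm \<xi> ^ 2 / (2 * (1 + norm \<xi> ^ 2))) * t) * (1 + norm \<xi> ^ 2) powr (\<delta> / 2)"
  shows "Linf_norm (inverse_fourier (\<lambda>\<xi>. of_real (q \<xi>) * fourier g \<xi>))
    \<le> ennreal (2 * K * t powr (- real CARD('n) / 2)) * L1_norm g
      + ennreal (K * sqrt (LINT \<xi>::real^'n|lborel. (1 + norm \<xi> ^ 2) powr (- s)) * exp (- t / 4)) * sobolev_norm (s + \<delta>) g"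
proof -
  note [measurable] = fourier_measurable[OF schwartz_integrable[OF g]]
  let ?J = "\<lambda>\<xi>::real^'n. 1 + norm \<xi> ^ 2"
  let ?F = "\<lambda>\<xi>. of_real (q \<xi>) * fourier g \<xi>"
  define n where "n = real CARD('n)"
  define c where "c = (2 * pi) powr (- n / 2)"
  define L where "L = (LINT x|lborel. norm (g x))"
  \<comment> \<open>Chosen so that gauss(\<gamma> \<xi>) = exp(-|\<xi>|^2 t / 4), which matches the
    bound 2 (1 + |\<xi>|^2) \<le> 4 on the denominator in the unit ball.\<close>
  define \<gamma> where "\<gamma> = sqrt (t / 2)"
  \<comment> \<open>The factor 2 bounds (1 + |\<xi>|^2)^(\<delta> / 2) in the unit ball, and
    \<open>c * L\<close> bounds the transform of \<open>g\<close>.\<close>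
  define A where "A = 2 * K * (c * L)"
  define E where "E = K * exp (- t / 4)"
  define W where "W = sqrt (LINT \<xi>|lborel. ?J \<xi> powr (- s))"
  have n1: "n \<ge> 1" using zero_less_card_finite[where 'a='n] unfolding n_def by linarith
  have c: "c > 0" "c \<le> 1"
    using n1 pi_gt3 powr_mono2'[of "- n / 2" 1 "2 * pi"] by (auto simp: c_def)
  have L0: "L \<ge> 0" by (simp add: L_def)
  have A0: "A \<ge> 0" and E0: "E \<ge> 0" using c L0 K by (auto simp: A_def E_def)
  have \<gamma>: "\<gamma> > 0" using t by (simp add: \<gamma>_def)
  have gauss_\<gamma>: "gauss (\<gamma> *\<^sub>R \<xi>) = exp (- (norm \<xi> ^ 2 / 4) * t)" for \<xi> :: "real^'n"
    using t by (simp add: gauss_def \<gamma>_def power_mult_distrib field_simps)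
  have pointwise: "norm (?F \<xi>) \<le> A * gauss (\<gamma> *\<^sub>R \<xi>) + E * (?J \<xi> powr (\<delta> / 2) * norm (fourier g \<xi>))" for \<xi>
  proof (cases "norm \<xi> ^ 2 \<le> 1")
    case True
    have "norm \<xi> ^ 2 / 4 \<le> norm \<xi> ^ 2 / (2 * ?J \<xi>)"
      by (rule divide_left_mono) (use True in \<open>auto simp: add_pos_nonneg\<close>)
    then have "exp (- (norm \<xi> ^ 2 / (2 * ?J \<xi>)) * t) \<le> gauss (\<gamma> *\<^sub>R \<xi>)"
      using t unfolding gauss_\<gamma> exp_le_cancel_iff by (intro mult_right_mono) simp_all
    moreover have "?J \<xi> powr (\<delta> / 2) \<le> 2 powr 1"
    proof -
      have "?J \<xi> powr (\<delta> / 2) \<le> 2 powr (\<delta> / 2)"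
        by (rule powr_mono2) (use True \<delta> in auto)
      also have "\<dots> \<le> 2 powr 1" by (rule powr_mono) (use \<delta> in auto)
      finally show ?thesis .
    qed
    ultimately have "K * exp (- (norm \<xi> ^ 2 / (2 * ?J \<xi>)) * t) * ?J \<xi> powr (\<delta> / 2) \<le> K * gauss (\<gamma> *\<^sub>R \<xi>) * 2"
      using K by (intro mult_mono) (auto simp: gauss_def)
    with bd[of \<xi>] have "\<bar>q \<xi>\<bar> \<le> K * gauss (\<gamma> *\<^sub>R \<xi>) * 2" by linarith
    moreover have "norm (fourier g \<xi>) \<le> c * L"
      using norm_fourier_le[of g \<xi>] by (simp add: c_def L_def n_def)
    ultimately have "norm (?F \<xi>) \<le> (K * gauss (\<gamma> *\<^sub>R \<xi>) * 2) * (c * L)"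
      unfolding norm_mult norm_of_real by (rule mult_mono) (use K in \<open>auto simp: gauss_def\<close>)
    also have "\<dots> = A * gauss (\<gamma> *\<^sub>R \<xi>)" by (simp add: A_def)
    finally show ?thesis using E0 by (simp add: add_increasing2)
  next
    case False
    have "1 / 4 \<le> norm \<xi> ^ 2 / (2 * ?J \<xi>)"
      using False by (simp add: field_simps add_pos_nonneg)
    then have "exp (- (norm \<xi> ^ 2 / (2 * ?J \<xi>)) * t) \<le> exp (- t / 4)"
      using mult_right_mono[of "1 / 4" "norm \<xi> ^ 2 / (2 * ?J \<xi>)" t] t by simp
    then have "K * exp (- (norm \<xi> ^ 2 / (2 * ?J \<xi>)) * t) * ?J \<xi> powr (\<delta> / 2) \<le> E * ?J \<xi> powr (\<delta> / 2)"
      unfolding E_def using K by (intro mult_right_mono mult_left_mono) auto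
    with bd[of \<xi>] have "\<bar>q \<xi>\<bar> \<le> E * ?J \<xi> powr (\<delta> / 2)" by linarith
    then have "norm (?F \<xi>) \<le> E * ?J \<xi> powr (\<delta> / 2) * norm (fourier g \<xi>)"
      unfolding norm_mult norm_of_real by (rule mult_right_mono) simp
    also have "\<dots> = E * (?J \<xi> powr (\<delta> / 2) * norm (fourier g \<xi>))" by simp
    finally show ?thesis
      using A0 gauss_pos[of "\<gamma> *\<^sub>R \<xi>"] by (simp add: add_increasing less_imp_le)
  qed
  \<comment> \<open>The undilated Gaussian has integral (2 pi)^(n/2), which is
    \<open>inverse c\<close>.\<close>
  have low: "(\<integral>\<^sup>+ \<xi>. ennreal (A * gauss (\<gamma> *\<^sub>R \<xi> :: real^'n)) \<partial>lborel) = ennreal (A * (inverse c * \<gamma> powr (- n)))"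
    using integral_dilated_gauss[OF \<gamma>, where 'a="real^'n"] A0 gauss_pos[where 'a="real^'n"]
    by (subst nn_integral_eq_integral) (simp_all add: less_imp_le c_def n_def powr_minus)
  have "\<gamma> powr (- n) = (t / 2) powr (- n / 2)"
    using t by (simp add: \<gamma>_def powr_half_sqrt[symmetric] powr_powr)
  also have "\<dots> = t powr (- n / 2) * 2 powr (n / 2)"
    using t by (simp add: powr_divide powr_minus field_simps)
  finally have \<gamma>n: "\<gamma> powr (- n) = t powr (- n / 2) * 2 powr (n / 2)" .
  \<comment> \<open>Of the two factors \<open>c\<close>, one from the inverse transform and one
    inside \<open>A\<close>, the Gaussian integral cancels one. The other absorbs the 2^(n/2) coming
    from \<gamma>, so no dimensional constant survives.\<close>
  have "c * 2 powr (n / 2) = pi powr (- n / 2)"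
    by (simp add: c_def powr_mult powr_minus field_simps)
  also have "\<dots> \<le> 1" using n1 pi_gt3 powr_mono2'[of "- n / 2" 1 pi] by simp
  finally have c2: "c * 2 powr (n / 2) \<le> 1" .
  have "c * (A * (inverse c * \<gamma> powr (- n))) = (c * 2 powr (n / 2)) * (2 * K * t powr (- n / 2) * L)"
    using c by (simp add: A_def \<gamma>n field_simps)
  also have "\<dots> \<le> 2 * K * t powr (- n / 2) * L"
    using c c2 K L0 by (intro mult_left_le_one_le) auto
  finally have low_const: "c * (A * (inverse c * \<gamma> powr (- n))) \<le> 2 * K * t powr (- n / 2) * L" .
  \<comment> \<open>Without the exponential factor the bound takes the form under which the product
    with the transform of \<open>g\<close> is integrable.\<close>
  have bd': "\<bar>q \<xi>\<bar> \<le> K * ?J \<xi> powr (\<delta> / 2)" for \<xi>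
  proof -
    have "exp (- (norm \<xi> ^ 2 / (2 * ?J \<xi>)) * t) \<le> 1" using t by simp
    then have "K * exp (- (norm \<xi> ^ 2 / (2 * ?J \<xi>)) * t) * ?J \<xi> powr (\<delta> / 2) \<le> K * 1 * ?J \<xi> powr (\<delta> / 2)"
      using K by (intro mult_right_mono mult_left_mono) auto
    with bd[of \<xi>] show ?thesis by simp
  qed
  have "Linf_norm (inverse_fourier ?F) \<le> ennreal c * (\<integral>\<^sup>+ \<xi>. ennreal (norm (?F \<xi>)) \<partial>lborel)"
    unfolding c_def n_def by (rule Linf_norm_inverse_fourier_le multiplier_integrable[OF g q bd' K \<delta>(2)])+
  also have "(\<integral>\<^sup>+ \<xi>. ennreal (norm (?F \<xi>)) \<partial>lborel)
      \<le> (\<integral>\<^sup>+ \<xi>. ennreal (A * gauss (\<gamma> *\<^sub>R \<xi>)) + ennreal E * ennreal (?J \<xi> powr (\<delta> / 2) * norm (fourier g \<xi>)) \<partial>lborel)"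
  proof (rule nn_integral_mono)
    fix \<xi> :: "real^'n"
    have "ennreal (norm (?F \<xi>)) \<le> ennreal (A * gauss (\<gamma> *\<^sub>R \<xi>) + E * (?J \<xi> powr (\<delta> / 2) * norm (fourier g \<xi>)))"
      by (rule ennreal_leI[OF pointwise])
    also have "\<dots> = ennreal (A * gauss (\<gamma> *\<^sub>R \<xi>)) + ennreal E * ennreal (?J \<xi> powr (\<delta> / 2) * norm (fourier g \<xi>))"
      using A0 E0 gauss_pos[of "\<gamma> *\<^sub>R \<xi>"] by (subst ennreal_plus) (auto simp: ennreal_mult less_imp_le)
    finally show "ennreal (norm (?F \<xi>)) \<le> \<dots>" .
  qed
  also have "\<dots> = ennreal (A * (inverse c * \<gamma> powr (- n)))
      + ennreal E * (\<integral>\<^sup>+ \<xi>. ennreal (?J \<xi> powr (\<delta> / 2) * norm (fourier g \<xi>)) \<partial>lborel)"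
    by (subst nn_integral_add) (auto simp: low nn_integral_cmult)
  also have "\<dots> \<le> ennreal (A * (inverse c * \<gamma> powr (- n))) + ennreal E * (ennreal W * sobolev_norm (s + \<delta>) g)"
    unfolding W_def by (intro add_left_mono mult_left_mono nn_integral_fourier_weighted_le g s) auto
  finally have "Linf_norm (inverse_fourier ?F)
      \<le> ennreal c * (ennreal (A * (inverse c * \<gamma> powr (- n))) + ennreal E * (ennreal W * sobolev_norm (s + \<delta>) g))"
    by (simp add: mult_left_mono)
  also have "\<dots> = ennreal (c * (A * (inverse c * \<gamma> powr (- n)))) + ennreal (c * (W * E)) * sobolev_norm (s + \<delta>) g"
    using c A0 E0 \<gamma> by (simp add: distrib_left ennreal_mult W_def mult_ac)
  also have "\<dots> \<le> ennreal (2 * K * t powr (- n / 2) * L) + ennreal (W * E) * sobolev_norm (s + \<delta>) g"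
    using c E0 by (intro add_mono mult_right_mono ennreal_leI low_const mult_left_le_one_le) (auto simp: W_def)
  also have "ennreal (2 * K * t powr (- n / 2) * L) = ennreal (2 * K * t powr (- n / 2)) * L1_norm g"
    using K L0 by (simp add: L1_norm_eq schwartz_integrable g L_def ennreal_mult)
  finally show ?thesis by (simp add: n_def W_def E_def mult_ac)
qed

section \<open>The symbols\<close>

definition damp :: "real \<Rightarrow> real" where "damp r = r / (2 * (1 + r))"

definition osc :: "real \<Rightarrow> real" where "osc r = r * sqrt (3 + 4 * r) / (2 * (1 + r))"

text \<open>The quotient \<open>damp r / osc r\<close> from the product rule is replaced by
  \<open>1 / sqrt (3 + 4 * r)\<close>, so the formula is regular at r = 0.\<close>

definition symb_dt :: "real \<Rightarrow> real \<Rightarrow> real" where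
  "symb_dt r t = exp (- damp r * t) * (cos (osc r * t) - sin (osc r * t) / sqrt (3 + 4 * r))"

definition symb_dt2 :: "real \<Rightarrow> real \<Rightarrow> real" where
  "symb_dt2 r t = exp (- damp r * t) *
     ((damp r / sqrt (3 + 4 * r) - osc r) * sin (osc r * t) - 2 * damp r * cos (osc r * t))"

text \<open>The symbol of S(t) times r, with the singular factor 1 / r cancelled; up to sign it is
  the symbol of S(t) composed with the Laplacian.\<close>

definition symb_times_r :: "real \<Rightarrow> real \<Rightarrow> real" where
  "symb_times_r r t = exp (- damp r * t) * (2 * (1 + r) / sqrt (3 + 4 * r)) * sin (osc r * t)"

section \<open>Time derivatives of the symbol\<close>

lemma damp_eq_osc: "r \<ge> 0 \<Longrightarrow> damp r = osc r / sqrt (3 + 4 * r)"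
  by (simp add: damp_def osc_def)

lemma symb_eq:
  assumes "\<xi> \<noteq> 0"
  shows "symb \<xi> t = exp (- damp (norm \<xi> ^ 2) * t) / osc (norm \<xi> ^ 2) * sin (osc (norm \<xi> ^ 2) * t)"
  using assms by (simp add: symb_def damp_def osc_def)

lemma norm_square_times_symb: "norm \<xi> ^ 2 * symb \<xi> t = symb_times_r (norm \<xi> ^ 2) t"
  by (cases "\<xi> = 0") (auto simp: symb_times_r_def osc_def symb_eq)

lemma osc_pos: "r > 0 \<Longrightarrow> osc r > 0"
  by (simp add: osc_def)

text \<open>Frequency 0 is separate because the symbol is t there; its derivative 1 agrees with the
  value of \<open>symb_dt\<close> at r = 0.\<close>

lemma deriv_symb: "deriv (symb \<xi>) = symb_dt (norm \<xi> ^ 2)"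
proof
  fix t
  show "deriv (symb \<xi>) t = symb_dt (norm \<xi> ^ 2) t"
  proof (cases "\<xi> = 0")
    case True
    then have "symb \<xi> = (\<lambda>t. t)" by (auto simp: symb_def)
    then show ?thesis using True by (simp add: symb_dt_def damp_def osc_def)
  next
    case False
    define r where "r = norm \<xi> ^ 2"
    have r: "r > 0" using False by (simp add: r_def)
    have "symb \<xi> = (\<lambda>t. exp (- damp r * t) / osc r * sin (osc r * t))"
      using symb_eq[OF False] by (auto simp: r_def)
    moreover have "((\<lambda>t. exp (- damp r * t) / osc r * sin (osc r * t)) has_real_derivative symb_dt r t) (at t)"
      using osc_pos[OF r] r damp_eq_osc[of r]
      by (auto intro!: derivative_eq_intros simp: symb_dt_def field_simps)
    ultimately show ?thesis by (simp add: DERIV_imp_deriv r_def)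
  qed
qed

lemma deriv_symb_dt:
  assumes "r \<ge> 0"
  shows "deriv (symb_dt r) t = symb_dt2 r t"
proof -
  define d where "d = 1 / sqrt (3 + 4 * r)"
  have "symb_dt r = (\<lambda>t. exp (- damp r * t) * (cos (osc r * t) - d * sin (osc r * t)))"
    by (simp add: symb_dt_def d_def fun_eq_iff)
  moreover have "((\<lambda>t. exp (- damp r * t) * (cos (osc r * t) - d * sin (osc r * t))) has_real_derivative
      exp (- damp r * t) * (- damp r) * (cos (osc r * t) - d * sin (osc r * t))
      + exp (- damp r * t) * (- sin (osc r * t) * osc r - d * (cos (osc r * t) * osc r))) (at t)"
    by (auto intro!: derivative_eq_intros)
  moreover have "exp (- damp r * t) * (- damp r) * (cos (osc r * t) - d * sin (osc r * t))
      + exp (- damp r * t) * (- sin (osc r * t) * osc r - d * (cos (osc r * t) * osc r)) = symb_dt2 r t"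
  proof -
    \<comment> \<open>This identity merges the two cosine terms, -damp and -d osc, into -2
      damp.\<close>
    have "damp r = osc r * d" using damp_eq_osc[OF assms] by (simp add: d_def)
    moreover have "damp r / sqrt (3 + 4 * r) = damp r * d" by (simp add: d_def)
    ultimately show ?thesis by (simp add: symb_dt2_def algebra_simps)
  qed
  ultimately have "(symb_dt r has_real_derivative symb_dt2 r t) (at t)"
    by simp
  then show ?thesis by (rule DERIV_imp_deriv)
qed

lemma deriv2_symb: "(deriv ^^ 2) (symb \<xi>) t = symb_dt2 (norm \<xi> ^ 2) t"
  by (simp add: numeral_2_eq_2 deriv_symb deriv_symb_dt)

section \<open>Pointwise bounds on the symbols\<close>

lemma damp_bounds: "r \<ge> 0 \<Longrightarrow> 0 \<le> damp r" "r \<ge> 0 \<Longrightarrow> 2 * damp r \<le> 1"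
  by (auto simp: damp_def)

lemma sqrt_lower: "r \<ge> 0 \<Longrightarrow> 1 \<le> sqrt (3 + 4 * r)" "r \<ge> 0 \<Longrightarrow> sqrt (1 + r) \<le> sqrt (3 + 4 * r)"
  by auto

text \<open>Here r / (1 + r) \<le> 1 and 3 + 4 r \<le> 4 (1 + r).\<close>

lemma osc_le:
  assumes "r \<ge> 0"
  shows "osc r \<le> sqrt (1 + r)"
proof -
  have "osc r = r / (1 + r) * (sqrt (3 + 4 * r) / 2)" by (simp add: osc_def)
  also have "\<dots> \<le> sqrt (3 + 4 * r) / 2"
    using assms by (intro mult_left_le_one_le) auto
  also have "\<dots> \<le> sqrt (4 * (1 + r)) / 2" by simp
  also have "\<dots> = sqrt (1 + r)" unfolding real_sqrt_mult by simp
  finally show ?thesis .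
qed

lemma abs_divide_sqrt_le: "r \<ge> 0 \<Longrightarrow> \<bar>x\<bar> / sqrt (3 + 4 * r) \<le> \<bar>x\<bar>"
  using divide_left_mono[OF sqrt_lower(1), of r "\<bar>x\<bar>"] by simp

lemma abs_symb_dt_le:
  assumes "r \<ge> 0"
  shows "\<bar>symb_dt r t\<bar> \<le> 2 * exp (- damp r * t)"
proof -
  have "\<bar>cos (osc r * t) - sin (osc r * t) / sqrt (3 + 4 * r)\<bar>
      \<le> \<bar>cos (osc r * t)\<bar> + \<bar>sin (osc r * t)\<bar> / sqrt (3 + 4 * r)"
    using abs_triangle_ineq4[of "cos (osc r * t)" "sin (osc r * t) / sqrt (3 + 4 * r)"] assms by simp
  also have "\<dots> \<le> 1 + 1"
    using abs_divide_sqrt_le[OF assms, of "sin (osc r * t)"] by (intro add_mono) (auto intro: order_trans)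
  finally show ?thesis by (simp add: symb_dt_def abs_mult)
qed

text \<open>Lowering sqrt(3 + 4 r) to sqrt(1 + r) in the denominator leaves (1 + r) / sqrt(1 +
  r).\<close>

lemma abs_symb_times_r_le:
  assumes "r \<ge> 0"
  shows "\<bar>symb_times_r r t\<bar> \<le> 2 * exp (- damp r * t) * sqrt (1 + r)"
proof -
  have "\<bar>symb_times_r r t\<bar> = exp (- damp r * t) * (2 * (1 + r) / sqrt (3 + 4 * r)) * \<bar>sin (osc r * t)\<bar>"
    using assms by (simp add: symb_times_r_def abs_mult)
  also have "\<dots> \<le> exp (- damp r * t) * (2 * (1 + r) / sqrt (1 + r)) * 1"
    using assms by (intro mult_mono divide_left_mono sqrt_lower) auto
  also have "2 * (1 + r) / sqrt (1 + r) = 2 * sqrt (1 + r)"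
    using assms real_div_sqrt[of "1 + r"] by (metis add_nonneg_nonneg times_divide_eq_right zero_le_one)
  finally show ?thesis by simp
qed

text \<open>Only \<open>osc\<close>, of order sqrt(1 + r), grows; the terms containing
  \<open>damp\<close> stay bounded since \<open>damp\<close> is at most 1/2.\<close>

lemma abs_symb_dt2_le:
  assumes r: "r \<ge> 0" and t: "t > 0"
  shows "\<bar>symb_dt2 r t\<bar> \<le> 3 * sqrt (1 + r)"
proof -
  \<comment> \<open>The sum 1/2 + c + 1 is at most 3 c because c \<ge> 1; it is applied with c =
    sqrt(1 + r).\<close>
  have combine: "\<bar>x - y\<bar> \<le> 3 * c" if "\<bar>x\<bar> \<le> (1 / 2 + c) * 1" "\<bar>y\<bar> \<le> 1 * 1" "1 \<le> c" for x y c :: real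
    using abs_triangle_ineq4[of x y] that by simp
  have J: "1 \<le> sqrt (1 + r)" using r by simp
  have "\<bar>damp r / sqrt (3 + 4 * r) - osc r\<bar> \<le> damp r / sqrt (3 + 4 * r) + osc r"
    using damp_bounds[OF r] r by (simp add: osc_def abs_le_iff)
  also have "\<dots> \<le> 1 / 2 + sqrt (1 + r)"
    using abs_divide_sqrt_le[OF r, of "damp r"] damp_bounds[OF r] osc_le[OF r] by simp
  finally have "\<bar>(damp r / sqrt (3 + 4 * r) - osc r) * sin (osc r * t)\<bar> \<le> (1 / 2 + sqrt (1 + r)) * 1"
    unfolding abs_mult by (intro mult_mono) (use r in auto)
  moreover have "\<bar>2 * damp r * cos (osc r * t)\<bar> \<le> 1 * 1"
    unfolding abs_mult[of "2 * damp r"] by (intro mult_mono) (use damp_bounds[OF r] in auto)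
  ultimately have "\<bar>(damp r / sqrt (3 + 4 * r) - osc r) * sin (osc r * t) - 2 * damp r * cos (osc r * t)\<bar>
      \<le> 3 * sqrt (1 + r)"
    using J by (rule combine)
  moreover have "exp (- damp r * t) \<le> 1" using damp_bounds[OF r] t by simp
  ultimately have "exp (- damp r * t) *
      \<bar>(damp r / sqrt (3 + 4 * r) - osc r) * sin (osc r * t) - 2 * damp r * cos (osc r * t)\<bar> \<le> 1 * (3 * sqrt (1 + r))"
    by (intro mult_mono) auto
  then show ?thesis by (simp add: symb_dt2_def abs_mult)
qed

lemma continuous_symbols:
  shows "continuous_on UNIV (\<lambda>\<xi>::'a::real_normed_vector. symb_dt (norm \<xi> ^ 2) t)"
    and "continuous_on UNIV (\<lambda>\<xi>::'a. symb_dt2 (norm \<xi> ^ 2) t)"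
    and "continuous_on UNIV (\<lambda>\<xi>::'a. symb_times_r (norm \<xi> ^ 2) t)"
proof -
  have "1 + norm \<xi> ^ 2 \<noteq> 0" "3 + 4 * norm \<xi> ^ 2 \<noteq> 0" for \<xi> :: 'a
    by (smt (verit) zero_le_power2)+
  then show "continuous_on UNIV (\<lambda>\<xi>::'a::real_normed_vector. symb_dt (norm \<xi> ^ 2) t)"
    and "continuous_on UNIV (\<lambda>\<xi>::'a. symb_dt2 (norm \<xi> ^ 2) t)"
    and "continuous_on UNIV (\<lambda>\<xi>::'a. symb_times_r (norm \<xi> ^ 2) t)"
    unfolding symb_dt_def symb_dt2_def symb_times_r_def damp_def osc_def
    by (auto intro!: continuous_intros simp del: distrib_left_numeral)
qed

section \<open>The operators as multipliers and their norm estimates\<close>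

lemma dS_1: "dS 1 t g = inverse_fourier (\<lambda>\<xi>. of_real (symb_dt (norm \<xi> ^ 2) t) * fourier g \<xi>)"
  by (simp add: dS_def fourier_multiplier_def deriv_symb)

lemma dS_2: "dS 2 t g = inverse_fourier (\<lambda>\<xi>. of_real (symb_dt2 (norm \<xi> ^ 2) t) * fourier g \<xi>)"
  by (simp add: dS_def fourier_multiplier_def deriv2_symb)

lemma dS_0_laplacian:
  assumes "g \<in> schwartz"
  shows "dS 0 t (laplacian g)
    = inverse_fourier (\<lambda>\<xi>. of_real (- symb_times_r (norm \<xi> ^ 2) t) * fourier g \<xi>)"
  unfolding dS_def fourier_multiplier_def fourier_laplacian[OF assms] norm_square_times_symb[symmetric]
  by (simp add: mult_ac)

lemma dS_1_laplacian:
  assumes "g \<in> schwartz"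
  shows "dS 1 t (laplacian g)
    = inverse_fourier (\<lambda>\<xi>. of_real (- (norm \<xi> ^ 2 * symb_dt (norm \<xi> ^ 2) t)) * fourier g \<xi>)"
  unfolding dS_1 fourier_laplacian[OF assms] by (simp add: mult_ac)

text \<open>The general bound is applied with K = 2 and index s + 1 > n / 2: with \<delta> = 0 for
  the first time derivative, whose symbol is bounded, and with \<delta> = 1 for the Laplacian term,
  whose symbol grows like sqrt(1 + |\<xi>|^2).\<close>

lemma Linf_decay:
  fixes g :: "real^'n::finite \<Rightarrow> complex"
  assumes g: "g \<in> schwartz" and t: "t > 0" and s: "s > (real CARD('n) - 2) / 2"
    and D: "D = 1 + 2 * sqrt (LINT \<xi>::real^'n|lborel. (1 + norm \<xi> ^ 2) powr (- (s + 1)))"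
  shows "Linf_norm (dS 1 t g)
      \<le> ennreal (4 * t powr (- real CARD('n) / 2)) * L1_norm g
        + ennreal (D * exp (- t / 4)) * sobolev_norm (s + 1) g" (is ?A)
    and "Linf_norm (dS 0 t (laplacian g))
      \<le> ennreal (4 * t powr (- real CARD('n) / 2)) * L1_norm g
        + ennreal (D * exp (- t / 4)) * sobolev_norm (s + 2) g" (is ?B)
proof -
  let ?W = "sqrt (LINT \<xi>::real^'n|lborel. (1 + norm \<xi> ^ 2) powr (- (s + 1)))"
  have s': "s + 1 > real CARD('n) / 2" using s by (simp add: field_simps)
  have s2: "s + 2 = s + 1 + 1" by simp
  have le: "ennreal (2 * ?W * exp (- t / 4)) \<le> ennreal (D * exp (- t / 4))"
    unfolding D by (intro ennreal_leI mult_right_mono) auto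
  have bd: "\<bar>symb_dt (norm \<xi> ^ 2) t\<bar> \<le> 2 * exp (- (norm \<xi> ^ 2 / (2 * (1 + norm \<xi> ^ 2))) * t) *
      (1 + norm \<xi> ^ 2) powr (0 / 2)" for \<xi> :: "real^'n"
  proof -
    have "1 + norm \<xi> ^ 2 \<noteq> 0" by (smt (verit) zero_le_power2)
    then show ?thesis using abs_symb_dt_le[of "norm \<xi> ^ 2" t] by (simp add: damp_def)
  qed
  have "Linf_norm (dS 1 t g) \<le> ennreal (2 * 2 * t powr (- real CARD('n) / 2)) * L1_norm g
      + ennreal (2 * ?W * exp (- t / 4)) * sobolev_norm (s + 1 + 0) g"
    unfolding dS_1 by (intro Linf_norm_multiplier_le g continuous_symbols t s' bd) auto
  also have "\<dots> \<le> ennreal (4 * t powr (- real CARD('n) / 2)) * L1_norm g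
        + ennreal (D * exp (- t / 4)) * sobolev_norm (s + 1) g"
    using le by (simp add: mult_right_mono)
  finally show ?A .
  have "Linf_norm (dS 0 t (laplacian g)) \<le> ennreal (2 * 2 * t powr (- real CARD('n) / 2)) * L1_norm g
      + ennreal (2 * ?W * exp (- t / 4)) * sobolev_norm (s + 2) g"
    using abs_symb_times_r_le unfolding dS_0_laplacian[OF g] s2
    by (intro Linf_norm_multiplier_le g continuous_on_minus continuous_symbols t s')
      (auto simp: damp_def powr_half_sqrt add_nonneg_nonneg)
  also have "\<dots> \<le> ennreal (4 * t powr (- real CARD('n) / 2)) * L1_norm g
        + ennreal (D * exp (- t / 4)) * sobolev_norm (s + 2) g"
    using le by (simp add: mult_right_mono)
  finally show ?B .
qed

text \<open>The four symbols have orders 0, 1, 1 and 2. Subtracting the order from s in the first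
  two cases and from s + 1 in the last two gives the indices on the left.\<close>

lemma sobolev_bounds:
  fixes g :: "real^'n::finite \<Rightarrow> complex"
  assumes g: "g \<in> schwartz" and t: "t > 0"
  shows "sobolev_norm s (dS 1 t g) \<le> ennreal 4 * sobolev_norm s g"
    and "sobolev_norm (s - 1) (dS 2 t g) \<le> ennreal 4 * sobolev_norm s g"
    and "sobolev_norm s (dS 0 t (laplacian g)) \<le> ennreal 4 * sobolev_norm (s + 1) g"
    and "sobolev_norm (s - 1) (dS 1 t (laplacian g)) \<le> ennreal 4 * sobolev_norm (s + 1) g"
proof -
  let ?r = "\<lambda>\<xi>::real^'n. norm \<xi> ^ 2"
  have half: "(1 + ?r \<xi>) powr (1 / 2) = sqrt (1 + ?r \<xi>)" for \<xi>
    by (simp add: powr_half_sqrt)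
  have exp_le: "exp (- damp (?r \<xi>) * t) \<le> 1" for \<xi>
    using damp_bounds[of "?r \<xi>"] t by simp
  have dt: "\<bar>symb_dt (?r \<xi>) t\<bar> \<le> 4" for \<xi>
    using abs_symb_dt_le[of "?r \<xi>" t] exp_le[of \<xi>] zero_le_power2[of "norm \<xi>"] by linarith
  have "1 + ?r \<xi> \<noteq> 0" for \<xi> by (smt (verit) zero_le_power2)
  then have "\<bar>symb_dt (?r \<xi>) t\<bar> \<le> 4 * (1 + ?r \<xi>) powr (0 / 2)" for \<xi>
    using dt[of \<xi>] by simp
  from sobolev_norm_multiplier_le[OF g continuous_symbols(1) this, of s]
  show "sobolev_norm s (dS 1 t g) \<le> ennreal 4 * sobolev_norm s g"
    unfolding dS_1 by simp
  have "\<bar>symb_dt2 (?r \<xi>) t\<bar> \<le> 4 * (1 + ?r \<xi>) powr (1 / 2)" for \<xi>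
    using abs_symb_dt2_le[of "?r \<xi>" t] t unfolding half by (auto intro: order_trans)
  then show "sobolev_norm (s - 1) (dS 2 t g) \<le> ennreal 4 * sobolev_norm s g"
    using sobolev_norm_multiplier_le[OF g continuous_symbols(2)[of t], of 4 1 s] by (simp add: dS_2)
  have "\<bar>- symb_times_r (?r \<xi>) t\<bar> \<le> 4 * (1 + ?r \<xi>) powr (1 / 2)" for \<xi>
  proof -
    have "2 * exp (- damp (?r \<xi>) * t) * sqrt (1 + ?r \<xi>) \<le> 4 * sqrt (1 + ?r \<xi>)"
      using exp_le[of \<xi>] by (intro mult_right_mono) (linarith, simp)
    with abs_symb_times_r_le[of "?r \<xi>" t] have "\<bar>symb_times_r (?r \<xi>) t\<bar> \<le> 4 * sqrt (1 + ?r \<xi>)"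
      by (meson order_trans zero_le_power2)
    then show ?thesis unfolding half by simp
  qed
  then show "sobolev_norm s (dS 0 t (laplacian g)) \<le> ennreal 4 * sobolev_norm (s + 1) g"
    using sobolev_norm_multiplier_le[OF g continuous_on_minus[OF continuous_symbols(3)[of t]], of 4 1 "s + 1"]
    by (simp add: dS_0_laplacian[OF g])
  \<comment> \<open>The Laplacian contributes r \<le> 1 + r, a full factor of order 2, on top of the
    bounded first time derivative.\<close>
  have "\<bar>- (?r \<xi> * symb_dt (?r \<xi>) t)\<bar> \<le> 4 * (1 + ?r \<xi>) powr (2 / 2)" for \<xi>
  proof -
    have "?r \<xi> * \<bar>symb_dt (?r \<xi>) t\<bar> \<le> (1 + ?r \<xi>) * 4"
      by (intro mult_mono dt) auto
    then show ?thesis by (simp add: abs_mult)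
  qed
  moreover have "continuous_on UNIV (\<lambda>\<xi>::real^'n. - (?r \<xi> * symb_dt (?r \<xi>) t))"
    by (intro continuous_intros continuous_symbols)
  ultimately show "sobolev_norm (s - 1) (dS 1 t (laplacian g)) \<le> ennreal 4 * sobolev_norm (s + 1) g"
    using sobolev_norm_multiplier_le[OF g, of "\<lambda>\<xi>. - (?r \<xi> * symb_dt (?r \<xi>) t)" 4 2 "s + 1"]
    by (simp add: dS_1_laplacian[OF g] del: One_nat_def)
qed

theorem lemma3p4:
  shows "\<exists>C::real. C > 0 \<and>
    (\<forall>s::real. s > (real CARD('n::finite) - 2) / 2 \<longrightarrow>
      (\<exists>D::real. D > 0 \<and>
        (\<forall>g \<in> (schwartz :: (real^'n \<Rightarrow> complex) set). \<forall>t::real. t > 0 \<longrightarrow>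
          Linf_norm (dS 1 t g)
            \<le> ennreal (C * t powr (- real CARD('n) / 2)) * L1_norm g
              + ennreal (D * exp (- t / 4)) * sobolev_norm (s + 1) g \<and>
          Linf_norm (dS 0 t (laplacian g))
            \<le> ennreal (C * t powr (- real CARD('n) / 2)) * L1_norm g
              + ennreal (D * exp (- t / 4)) * sobolev_norm (s + 2) g))) \<and>
    (\<forall>s::real. \<forall>k \<in> {0, 1::nat}.
      \<forall>g \<in> (schwartz :: (real^'n \<Rightarrow> complex) set). \<forall>t::real. t > 0 \<longrightarrow>
        sobolev_norm (s - real k) (dS (k + 1) t g) \<le> ennreal C * sobolev_norm s g \<and>
        sobolev_norm (s - real k) (dS k t (laplacian g)) \<le> ennreal C * sobolev_norm (s + 1) g)"
\<comment> \<open>The constant 4 is 2 K with K = 2 in the supremum bounds, and it also exceeds the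
  constants 2 and 3 of the pointwise symbol bounds.\<close>
proof (rule exI[of _ 4], intro conjI allI impI ballI)
  fix s :: real
  assume s: "s > (real CARD('n) - 2) / 2"
  \<comment> \<open>Twice the square root of the weight integral, which depends on \<open>s\<close>;
    the summand 1 makes positivity immediate.\<close>
  define D where "D = 1 + 2 * sqrt (LINT \<xi>::real^'n|lborel. (1 + norm \<xi> ^ 2) powr (- (s + 1)))"
  have "D > 0" by (simp add: D_def add_pos_nonneg)
  then show "\<exists>D::real. D > 0 \<and>
      (\<forall>g \<in> (schwartz :: (real^'n \<Rightarrow> complex) set). \<forall>t::real. t > 0 \<longrightarrow>
        Linf_norm (dS 1 t g)
          \<le> ennreal (4 * t powr (- real CARD('n) / 2)) * L1_norm g
            + ennreal (D * exp (- t / 4)) * sobolev_norm (s + 1) g \<and>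
        Linf_norm (dS 0 t (laplacian g))
          \<le> ennreal (4 * t powr (- real CARD('n) / 2)) * L1_norm g
            + ennreal (D * exp (- t / 4)) * sobolev_norm (s + 2) g)"
    using Linf_decay[OF _ _ s D_def] by blast
next
  fix s t :: real and k :: nat and g :: "real^'n \<Rightarrow> complex"
  assume "k \<in> {0, 1}" "g \<in> schwartz" "t > 0"
  then show "sobolev_norm (s - real k) (dS (k + 1) t g) \<le> ennreal 4 * sobolev_norm s g"
    and "sobolev_norm (s - real k) (dS k t (laplacian g)) \<le> ennreal 4 * sobolev_norm (s + 1) g"
    using sobolev_bounds[of g t s] by (auto simp: numeral_2_eq_2)
qed simp

end
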